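(* Let $(\mathcal M,g)$ be a (complex, four-dimensional) hyper-Kähler space which admits a hidden tri-holomorphic Killing symmetry, i.e. $\mathcal M$ embeds in a solution of the level-$n$ hyper-Kähler hierarchy admitting a tri-holomorphic Killing symmetry, and let $K^{AA'_1\cdots A'_{2n-1}}$ and $\chi_{A'_1\cdots A'_{2n}}$ be the spinor fields on $\mathcal M$ associated to the symmetry (defined in the context). Then $\chi_{A'_1\cdots A'_{2n}}=0$ and there exists a symmetric spinor field $\phi_{A'_1\cdots A'_{2n}}$ on $\mathcal M$ such that $$\nabla_{AA'}\phi_{A'_1\cdots A'_{2n}}=K_{A(A'_1\cdots A'_{2n-1}}\varepsilon_{A'_{2n})A'} .$$
   Context: All considerations are local and holomorphic. A space-time is a complex 4-manifold $\mathcal M$ with holomorphic metric $g$ and compatible volume form; $T\mathcal M=S^A\otimes S^{A'}$ with $S^A,S^{A'}$ rank-two spin bundles carrying symplectic forms $\varepsilon_{AB},\varepsilon_{A'B'}$ whose product gives the metric (Penrose–Rindler conventions); $\nabla_{AA'}$ is the Levi-Civita connection; round brackets denote symmetrisation; $e^{AA'}$ is the canonical (soldering) 1-form. Hyper-Kähler means that the Ricci tensor and the self-dual Weyl spinor $C_{A'B'C'D'}$ vanish. Locally such metrics have the form $g=2dw\,dx+2dz\,dy-2\Theta_{xx}dz^2-2\Theta_{yy}dw^2+4\Theta_{xy}dw\,dz$ with $\Theta_{xw}+\Theta_{yz}+\Theta_{xx}\Theta_{yy}-\Theta_{xy}^2=0$. Level-$n$ hyper-Kähler hierarchy: let $\mathcal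 N$ have coordinates $x^{Ai}$, $A=0,1$, $i=0,\dots,n$, $\partial_{Ai}=\partial/\partial x^{Ai}$. A solution is a function $\Theta(x^{Ai})$ with $$\partial_{Ai}\partial_{B\,j-1}\Theta-\partial_{Bj}\partial_{A\,i-1}\Theta+\{\partial_{A\,i-1}\Theta,\partial_{B\,j-1}\Theta\}_{yx}=0,\qquad i,j=1,\dots,n,$$ where $y=x^{00}$, $x=-x^{10}$, $\{f,h\}_{yx}=f_yh_x-f_xh_y$; also $w=x^{01}$, $z=x^{11}$. The slices $x^{Ai}=$ const., $i\ge2$, are hyper-Kähler 4-manifolds with the metric $g=2dw\,dx+2dz\,dy-2\Theta_{xx}dz^2-2\Theta_{yy}dw^2+4\Theta_{xy}dw\,dz$; $\mathcal M$ embeds into the hierarchy if it is such a slice. Let $\pi_{A'}$ be fibre coordinates on the primed spin bundle, $\lambda=\pi_{0'}/\pi_{1'}$. The hierarchy has twistor functions, homogeneous of degree $n$, $$\omega^0=\pi_{1'}^n\Big[\sum_{i=0}^n\lambda^{n-i}x^{0i}+\sum_{i=0}^n\lambda^{n+1+i}\partial_{1i}\Theta+\cdots\Big],\quad \omega^1=\pi_{1'}^n\Big[\sum_{i=0}^n\lambda^{n-i}x^{1i}-\sum_{i=0}^n\lambda^{n+1+i}\partial_{0i}\Theta+\cdots\Big],$$ and $\Sigma_n=d\omega^0\wedge d\omega^1$ ($\pi_{A'}$ constant) is a homogeneous polynomial of degree $2n$ in $\pi_{A'}$. The twistor space $\mathcal{PT}_n$ of the hierarchy is the 3-dimensional complex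 manifold with local homogeneous coordinates $(\omega^A,\pi_{A'})$, fibred over $\mathbb{CP}^1$ by $[\pi_{A'}]$, of which $\mathcal N$ is the moduli space of sections with normal bundle $\mathcal O(n)\oplus\mathcal O(n)$; $\Sigma_n$ is a symplectic form on its fibres with values in $\mathcal O(2n)$. Put $\nu_n=\Sigma_n\wedge\pi_{A'}d\pi^{A'}$, a 3-form of weight $2n+2$. The twistor space $\mathcal{PT}_1$ of $\mathcal M$ (with fibrewise 2-form $\Sigma_1$ with values in $\mathcal O(2)$) is a region of an iterated blow-up of $\mathcal{PT}_n$, giving a map $p:\mathcal{PT}_1\to\mathcal{PT}_n$. A symmetry of the hierarchy solution is a vector field $K$ on $\mathcal N$ with a lift $\tilde K=K+\phi^{A'}_{B'}\pi_{A'}\partial/\partial\pi_{B'}$ to the primed spin bundle such that $\mathcal L_{\tilde K}\Sigma_n=0$; $\tilde K$ projects to a holomorphic vector field $\mathcal K$ on $\mathcal{PT}_n$. It is tri-holomorphic if $\phi^{A'}_{B'}=\mu\,\delta^{A'}_{B'}$ (equivalently $\mathcal K$ is tangent to the fibres of $\mathcal{PT}_n\to\mathbb{CP}^1$), and Killing if $\phi^{A'}_{A'}=0$. The spinor fields $K^{AA'_1\cdots A'_{2n-1}}$ and $\chi_{A'_1\cdots A'_{2n}}$ (symmetric in primed indices) on $\mathcal M$ are defined by pulling back the 2-form $p^*(\mathcal K\lrcorner\nu_n)$ from $\mathcal{PT}_1$ to the primed spin bundle of $\mathcal M$ and writing the result as $$K^{AA'_1\cdots A'_{2n-1}}e_A{}^{A'_{2n}}\pi_{A'_1}\cdots\pi_{A'_{2n}}\wedge\pi_{B'}d\pi^{B'}+\chi_{A'_1\cdots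 A'_{2n}}\pi^{A'_1}\cdots\pi^{A'_{2n}}\,\Sigma_1 .$$ *)

theory Defs
  imports "HOL-Analysis.Analysis" "HOL-Combinatorics.Combinatorics"
begin

text \<open>
  Everything is local and holomorphic: manifolds are open subsets of coordinate spaces, and all
  bundles (in particular the spin bundles) are trivialised.  Spinor indices range over the numeral
  type \<open>2\<close>, whose elements are \<open>0\<close> and \<open>1\<close> (and \<open>2 = 0\<close>); spinors of higher valence are functions
  on lists of indices.
\<close>

section \<open>Holomorphic functions and exterior calculus\<close>

definition holo :: "(complex ^ 'k \<Rightarrow> complex) \<Rightarrow> (complex ^ 'k) set \<Rightarrow> bool" where
  "holo f S \<longleftrightarrow> (\<forall>x\<in>S. \<exists>f'. (f has_derivative f') (at x) \<and> (\<forall>a v. f' (a *s v) = a * f' v))"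

text \<open>Points of the primed spin bundle: a point of the base and the fibre coordinates \<open>\<pi>\<^sub>A'\<close>.\<close>

type_synonym 'k spin_pt = "(complex, 'k) vec \<times> (complex, 2) vec"

definition holo_pair ::
  "('k::finite spin_pt \<Rightarrow> complex) \<Rightarrow> 'k spin_pt set \<Rightarrow> bool" where
  "holo_pair f S \<longleftrightarrow> (\<forall>z\<in>S. \<exists>f'. (f has_derivative f') (at z) \<and>
     (\<forall>a u \<rho>. f' (a *s u, a *s \<rho>) = a * f' (u, \<rho>)))"

abbreviation D ::
  "('a::real_normed_vector \<Rightarrow> 'b::real_normed_vector) \<Rightarrow> 'a \<Rightarrow> 'a \<Rightarrow> 'b" where
  "D f x v \<equiv> frechet_derivative f (at x) v"

text \<open>A 2-form is a function of a point and two tangent vectors, with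
  \<open>(\<alpha> \<and> \<beta>) u v = \<alpha> u * \<beta> v - \<alpha> v * \<beta> u\<close>.\<close>

definition wedge :: "('a \<Rightarrow> complex) \<Rightarrow> ('a \<Rightarrow> complex) \<Rightarrow> 'a \<Rightarrow> 'a \<Rightarrow> complex" where
  "wedge \<alpha> \<beta> u v = \<alpha> u * \<beta> v - \<alpha> v * \<beta> u"

definition pullback2 ::
  "('a::real_normed_vector \<Rightarrow> 'b::real_normed_vector) \<Rightarrow> ('b \<Rightarrow> 'b \<Rightarrow> 'b \<Rightarrow> complex)
     \<Rightarrow> 'a \<Rightarrow> 'a \<Rightarrow> 'a \<Rightarrow> complex" where
  "pullback2 F \<alpha> z u v = \<alpha> (F z) (D F z u) (D F z v)"

text \<open>Lie derivative of a 2-form, evaluated on coordinate-constant vector fields \<open>u\<close>, \<open>v\<close>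
  (so that \<open>[X, u] = - D X u\<close>).\<close>

definition lie_derivative2 ::
  "('a::real_normed_vector \<Rightarrow> 'a) \<Rightarrow> ('a \<Rightarrow> 'a \<Rightarrow> 'a \<Rightarrow> complex) \<Rightarrow> 'a \<Rightarrow> 'a \<Rightarrow> 'a \<Rightarrow> complex" where
  "lie_derivative2 X \<alpha> z u v =
     D (\<lambda>z'. \<alpha> z' u v) z (X z) + \<alpha> z (D X z u) v + \<alpha> z u (D X z v)"


section \<open>Spinor algebra\<close>

text \<open>Penrose--Rindler conventions: \<open>\<epsilon>\<^sub>0\<^sub>1 = \<epsilon>\<^sup>0\<^sup>1 = 1\<close>,
  \<open>\<xi>\<^sub>A = \<xi>\<^sup>B \<epsilon>\<^sub>B\<^sub>A\<close>, \<open>\<xi>\<^sup>A = \<epsilon>\<^sup>A\<^sup>B \<xi>\<^sub>B\<close>;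
  the same symbol serves for primed indices.\<close>

definition eps :: "2 \<Rightarrow> 2 \<Rightarrow> complex" where
  "eps A B = (if A = 0 \<and> B = 1 then 1 else if A = 1 \<and> B = 0 then -1 else 0)"

definition raise :: "complex ^ 2 \<Rightarrow> complex ^ 2" where
  "raise \<pi> = (\<chi> A. \<Sum>B\<in>UNIV. eps A B * \<pi> $ B)"

definition idx_lists :: "nat \<Rightarrow> 2 list set" where
  "idx_lists k = {is. length is = k}"

definition spinor_power :: "complex ^ 2 \<Rightarrow> 2 list \<Rightarrow> complex" where
  "spinor_power \<pi> is = (\<Prod>k<length is. \<pi> $ (is ! k))"

definition symmetrise :: "(2 list \<Rightarrow> complex) \<Rightarrow> 2 list \<Rightarrow> complex" where
  "symmetrise T is =
     (\<Sum>\<sigma> | \<sigma> permutes {..<length is}. T (permute_list \<sigma> is)) / fact (length is)"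

definition lower_all :: "(2 \<Rightarrow> 2 list \<Rightarrow> complex) \<Rightarrow> 2 \<Rightarrow> 2 list \<Rightarrow> complex" where
  "lower_all K A is = (\<Sum>B\<in>UNIV. \<Sum>js\<in>idx_lists (length is).
     K B js * eps B A * (\<Prod>k<length is. eps (js ! k) (is ! k)))"


section \<open>Complex four-dimensional metrics and spin connections\<close>

text \<open>Four-dimensional coordinates are \<open>x\<^sup>A\<^sup>i\<close> with \<open>A, i \<in> {0,1}\<close>; tangent vectors are
  identified with points of the coordinate space.\<close>

type_synonym pt4 = "(complex, 2 \<times> 2) vec"
type_synonym metric4 = "pt4 \<Rightarrow> pt4 \<Rightarrow> pt4 \<Rightarrow> complex"
type_synonym coframe4 = "2 \<Rightarrow> 2 \<Rightarrow> pt4 \<Rightarrow> pt4 \<Rightarrow> complex"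

definition spinor_field :: "nat \<Rightarrow> pt4 set \<Rightarrow> (pt4 \<Rightarrow> 2 list \<Rightarrow> complex) \<Rightarrow> bool" where
  "spinor_field k U \<phi> \<longleftrightarrow>
     (\<forall>is\<in>idx_lists k. holo (\<lambda>m. \<phi> m is) U) \<and>
     (\<forall>m\<in>U. \<forall>is\<in>idx_lists k. \<forall>js. mset js = mset is \<longrightarrow> \<phi> m js = \<phi> m is)"

definition holomorphic_metric :: "pt4 set \<Rightarrow> metric4 \<Rightarrow> bool" where
  "holomorphic_metric M g \<longleftrightarrow>
     (\<exists>G. (\<forall>a b. G a b = G b a \<and> holo (G a b) M) \<and>
          (\<forall>m\<in>M. \<forall>u v. g m u v = (\<Sum>a\<in>UNIV. \<Sum>b\<in>UNIV. G a b m * u $ a * v $ b))) \<and>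
     (\<forall>m\<in>M. \<forall>u. (\<forall>v. g m u v = 0) \<longrightarrow> u = 0)"

text \<open>\<open>levi_civita g m u v\<close> is \<open>\<nabla>\<^sub>u v\<close> at \<open>m\<close> for coordinate-constant fields \<open>u\<close>, \<open>v\<close>, i.e. the
  contraction of the Christoffel symbols with \<open>u\<close> and \<open>v\<close>; it is given by the Koszul formula.\<close>

definition levi_civita :: "metric4 \<Rightarrow> pt4 \<Rightarrow> pt4 \<Rightarrow> pt4 \<Rightarrow> pt4" where
  "levi_civita g m u v = (THE c. \<forall>w. 2 * g m c w =
     D (\<lambda>m'. g m' v w) m u + D (\<lambda>m'. g m' u w) m v - D (\<lambda>m'. g m' u v) m w)"

definition riemann :: "metric4 \<Rightarrow> pt4 \<Rightarrow> pt4 \<Rightarrow> pt4 \<Rightarrow> pt4 \<Rightarrow> pt4" where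
  "riemann g m u v w =
     D (\<lambda>m'. levi_civita g m' v w) m u - D (\<lambda>m'. levi_civita g m' u w) m v
     + levi_civita g m u (levi_civita g m v w) - levi_civita g m v (levi_civita g m u w)"

definition ricci :: "metric4 \<Rightarrow> pt4 \<Rightarrow> pt4 \<Rightarrow> pt4 \<Rightarrow> complex" where
  "ricci g m v w = (\<Sum>a\<in>UNIV. riemann g m (axis a 1) v w $ a)"

text \<open>A coframe \<open>\<theta> A A'\<close> stands for the components \<open>e\<^sup>A\<^sup>A'\<close> of the canonical 1-form;
  \<open>frame \<theta> A A'\<close> is the dual basis of vectors \<open>e\<^sub>A\<^sub>A'\<close>.\<close>

definition frame :: "coframe4 \<Rightarrow> 2 \<Rightarrow> 2 \<Rightarrow> pt4 \<Rightarrow> pt4" where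
  "frame \<theta> A A' m = (THE v. \<forall>B B'. \<theta> B B' m v = (if B = A \<and> B' = A' then 1 else 0))"

definition spin_coframe :: "pt4 set \<Rightarrow> metric4 \<Rightarrow> coframe4 \<Rightarrow> bool" where
  "spin_coframe M g \<theta> \<longleftrightarrow> (\<forall>m\<in>M. \<forall>u v. g m u v =
     (\<Sum>A\<in>UNIV. \<Sum>B\<in>UNIV. \<Sum>A'\<in>UNIV. \<Sum>B'\<in>UNIV.
        eps A B * eps A' B' * \<theta> A A' m u * \<theta> B B' m v))"

text \<open>The totally symmetric part of \<open>\<epsilon>\<^sup>A\<^sup>B \<epsilon>\<^sup>C\<^sup>D R\<^sub>A\<^sub>A'\<^sub>B\<^sub>B'\<^sub>C\<^sub>C'\<^sub>D\<^sub>D'\<close> is, up to normalisation,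
  \<open>C\<^sub>A'\<^sub>B'\<^sub>C'\<^sub>D'\<close>: the other irreducible parts of the Riemann tensor drop out.\<close>

definition sd_weyl :: "metric4 \<Rightarrow> coframe4 \<Rightarrow> pt4 \<Rightarrow> 2 list \<Rightarrow> complex" where
  "sd_weyl g \<theta> m = symmetrise (\<lambda>is. (1/4) *
     (\<Sum>A\<in>UNIV. \<Sum>B\<in>UNIV. \<Sum>C\<in>UNIV. \<Sum>E\<in>UNIV. eps A B * eps C E *
        g m (riemann g m (frame \<theta> A (is ! 0) m) (frame \<theta> B (is ! 1) m) (frame \<theta> C (is ! 2) m))
            (frame \<theta> E (is ! 3) m)))"

definition hyper_kaehler :: "pt4 set \<Rightarrow> metric4 \<Rightarrow> coframe4 \<Rightarrow> bool" where
  "hyper_kaehler M g \<theta> \<longleftrightarrow>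
     open M \<and> holomorphic_metric M g \<and> spin_coframe M g \<theta> \<and>
     (\<forall>m\<in>M. \<forall>u v. ricci g m u v = 0) \<and>
     (\<forall>m\<in>M. \<forall>is\<in>idx_lists 4. sd_weyl g \<theta> m is = 0)"

text \<open>Coefficients of the primed spin connection:
  \<open>\<nabla>\<^sub>u e\<^sub>A\<^sub>A' = \<gamma>\<^sub>A\<^sup>B e\<^sub>B\<^sub>A' + \<gamma>\<^sub>A'\<^sup>B' e\<^sub>A\<^sub>B'\<close> with both \<open>\<gamma>\<close> trace-free,
  hence \<open>2 \<gamma>\<^sub>A'\<^sup>B' = \<Sum>\<^sub>A e\<^sup>A\<^sup>B'(\<nabla>\<^sub>u e\<^sub>A\<^sub>A')\<close>.\<close>

definition primed_connection :: "metric4 \<Rightarrow> coframe4 \<Rightarrow> pt4 \<Rightarrow> pt4 \<Rightarrow> 2 \<Rightarrow> 2 \<Rightarrow> complex" where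
  "primed_connection g \<theta> m u A' B' = (1/2) *
     (\<Sum>A\<in>UNIV. \<theta> A B' m (D (frame \<theta> A A') m u + levi_civita g m u (frame \<theta> A A' m)))"

definition nabla ::
  "metric4 \<Rightarrow> coframe4 \<Rightarrow> (pt4 \<Rightarrow> 2 list \<Rightarrow> complex) \<Rightarrow> pt4 \<Rightarrow> 2 \<Rightarrow> 2 \<Rightarrow> 2 list \<Rightarrow> complex" where
  "nabla g \<theta> \<phi> m A A' is =
     (let u = frame \<theta> A A' m in
      D (\<lambda>m'. \<phi> m' is) m u
      - (\<Sum>k<length is. \<Sum>B'\<in>UNIV. primed_connection g \<theta> m u (is ! k) B' * \<phi> m (is[k := B'])))"


section \<open>The hyper-Kaehler hierarchy\<close>

text \<open>The coordinates of \<open>\<N>\<close> are \<open>x\<^sup>A\<^sup>i = x $ (A, lab i)\<close>, where \<open>lab\<close> is a labelling of a finite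
  type by \<open>0, \<dots>, n\<close>.  For four-dimensional spaces the labelling is \<open>of_nat :: nat \<Rightarrow> 2\<close>.\<close>

definition pd :: "(nat \<Rightarrow> 'i::finite) \<Rightarrow> 2 \<Rightarrow> nat \<Rightarrow> (complex ^ (2 \<times> 'i) \<Rightarrow> complex)
     \<Rightarrow> complex ^ (2 \<times> 'i) \<Rightarrow> complex" where
  "pd lab A i f x = D f x (axis (A, lab i) 1)"

text \<open>\<open>\<partial>\<^sub>y = \<partial>\<^sub>0\<^sub>0\<close> and \<open>\<partial>\<^sub>x = - \<partial>\<^sub>1\<^sub>0\<close>, as \<open>y = x\<^sup>0\<^sup>0\<close>, \<open>x = - x\<^sup>1\<^sup>0\<close>.\<close>

definition poisson_yx :: "(nat \<Rightarrow> 'i::finite) \<Rightarrow> (complex ^ (2 \<times> 'i) \<Rightarrow> complex)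
     \<Rightarrow> (complex ^ (2 \<times> 'i) \<Rightarrow> complex) \<Rightarrow> complex ^ (2 \<times> 'i) \<Rightarrow> complex" where
  "poisson_yx lab f h p =
     pd lab 0 0 f p * (- pd lab 1 0 h p) - (- pd lab 1 0 f p) * pd lab 0 0 h p"

definition hierarchy_solution :: "nat \<Rightarrow> (nat \<Rightarrow> 'i::finite) \<Rightarrow> (complex ^ (2 \<times> 'i)) set
     \<Rightarrow> (complex ^ (2 \<times> 'i) \<Rightarrow> complex) \<Rightarrow> bool" where
  "hierarchy_solution n lab N \<Theta> \<longleftrightarrow> open N \<and> holo \<Theta> N \<and>
     (\<forall>x\<in>N. \<forall>A B. \<forall>i\<in>{1..n}. \<forall>j\<in>{1..n}.
        pd lab A i (pd lab B (j - 1) \<Theta>) x - pd lab B j (pd lab A (i - 1) \<Theta>) x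
        + poisson_yx lab (pd lab A (i - 1) \<Theta>) (pd lab B (j - 1) \<Theta>) x = 0)"

text \<open>Primed spin vectors \<open>\<pi>\<^sub>A'\<close> for which \<open>\<lambda> = \<pi>\<^sub>0' / \<pi>\<^sub>1'\<close> lies in a disc about \<open>0\<close>, where
  the twistor functions are given by their expansions.\<close>

definition pi_cone :: "real \<Rightarrow> (complex ^ 2) set" where
  "pi_cone r = {\<pi>. \<pi> $ 1 \<noteq> 0 \<and> norm (\<pi> $ 0) < r * norm (\<pi> $ 1)}"

text \<open>\<open>\<Sigma>\<^sub>n = d\<omega>\<^sup>0 \<and> d\<omega>\<^sup>1\<close> with \<open>\<pi>\<^sub>A'\<close> held constant, as a 2-form on the primed spin bundle.\<close>

definition fibre_form :: "(2 \<Rightarrow> 'k::finite spin_pt \<Rightarrow> complex)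
     \<Rightarrow> 'k spin_pt \<Rightarrow> 'k spin_pt \<Rightarrow> 'k spin_pt
     \<Rightarrow> complex" where
  "fibre_form \<omega> z X Y =
     wedge (\<lambda>u. D (\<omega> 0) z (u, 0)) (\<lambda>u. D (\<omega> 1) z (u, 0)) (fst X) (fst Y)"

text \<open>\<open>a 0 k\<close> and \<open>a 1 k\<close> are the coefficients of \<open>\<lambda>\<^sup>k\<close> in the expansions of
  \<open>\<omega>\<^sup>0 / \<pi>\<^sub>1'\<^sup>n\<close> and \<open>\<omega>\<^sup>1 / \<pi>\<^sub>1'\<^sup>n\<close>; those with \<open>k > 2n + 1\<close> are not prescribed.\<close>

definition twistor_functions :: "nat \<Rightarrow> (nat \<Rightarrow> 'i::finite) \<Rightarrow> (complex ^ (2 \<times> 'i)) set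
     \<Rightarrow> (complex ^ (2 \<times> 'i) \<Rightarrow> complex) \<Rightarrow> real
     \<Rightarrow> (2 \<Rightarrow> (2 \<times> 'i) spin_pt \<Rightarrow> complex) \<Rightarrow> bool" where
  "twistor_functions n lab N \<Theta> r \<omega> \<longleftrightarrow> r > 0 \<and>
     (\<forall>A. holo_pair (\<omega> A) (N \<times> pi_cone r)) \<and>
     (\<forall>x\<in>N. \<exists>a :: 2 \<Rightarrow> nat \<Rightarrow> complex.
        (\<forall>i\<le>n. \<forall>A. a A (n - i) = x $ (A, lab i)) \<and>
        (\<forall>i\<le>n. a 0 (n + 1 + i) = pd lab 1 i \<Theta> x) \<and>
        (\<forall>i\<le>n. a 1 (n + 1 + i) = - pd lab 0 i \<Theta> x) \<and>
        (\<forall>A. \<forall>\<pi>\<in>pi_cone r.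
           (\<lambda>k. (\<pi> $ 1) ^ n * (a A k * (\<pi> $ 0 / \<pi> $ 1) ^ k)) sums \<omega> A (x, \<pi>))) \<and>
     (\<forall>x\<in>N. \<forall>u v. \<exists>s :: nat \<Rightarrow> complex. \<forall>\<pi>\<in>pi_cone r.
        fibre_form \<omega> (x, \<pi>) (u, 0) (v, 0) =
          (\<Sum>k\<le>2 * n. s k * (\<pi> $ 0) ^ k * (\<pi> $ 1) ^ (2 * n - k)))"


section \<open>Hyper-Kaehler slices\<close>

text \<open>The embedding of the four-dimensional slice on which \<open>x\<^sup>A\<^sup>i = c $ (A, lab i)\<close> for
  \<open>i \<ge> 2\<close>; the other components of \<open>c\<close> are irrelevant.\<close>

definition slice :: "(nat \<Rightarrow> 'i::finite) \<Rightarrow> complex ^ (2 \<times> 'i) \<Rightarrow> pt4 \<Rightarrow> complex ^ (2 \<times> 'i)" where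
  "slice lab c m = (\<chi> p. if snd p = lab 0 then m $ (fst p, 0)
     else if snd p = lab 1 then m $ (fst p, 1) else c $ p)"

definition dy :: "pt4 \<Rightarrow> complex" where "dy u = u $ (0, 0)"
definition dx :: "pt4 \<Rightarrow> complex" where "dx u = - (u $ (1, 0))"
definition dw :: "pt4 \<Rightarrow> complex" where "dw u = u $ (0, 1)"
definition dz :: "pt4 \<Rightarrow> complex" where "dz u = u $ (1, 1)"

definition theta_xx :: "(pt4 \<Rightarrow> complex) \<Rightarrow> pt4 \<Rightarrow> complex" where
  "theta_xx \<Theta> = pd of_nat 1 0 (pd of_nat 1 0 \<Theta>)"
definition theta_yy :: "(pt4 \<Rightarrow> complex) \<Rightarrow> pt4 \<Rightarrow> complex" where
  "theta_yy \<Theta> = pd of_nat 0 0 (pd of_nat 0 0 \<Theta>)"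
definition theta_xy :: "(pt4 \<Rightarrow> complex) \<Rightarrow> pt4 \<Rightarrow> complex" where
  "theta_xy \<Theta> m = - pd of_nat 1 0 (pd of_nat 0 0 \<Theta>) m"

definition heavenly_metric :: "(pt4 \<Rightarrow> complex) \<Rightarrow> metric4" where
  "heavenly_metric \<Theta> m u v =
     (dw u * dx v + dw v * dx u) + (dz u * dy v + dz v * dy u)
     - 2 * theta_xx \<Theta> m * dz u * dz v - 2 * theta_yy \<Theta> m * dw u * dw v
     + 2 * theta_xy \<Theta> m * (dw u * dz v + dw v * dz u)"

text \<open>The coframe \<open>e\<^sup>A\<^sup>A'\<close> in which \<open>\<Sigma>\<^sub>1 = e\<^sup>0\<^sup>A' \<pi>\<^sub>A' \<and> e\<^sup>1\<^sup>B' \<pi>\<^sub>B'\<close>, i.e. the one belonging to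
  the fibre coordinates \<open>\<pi>\<^sub>A'\<close> that occur in the twistor functions.\<close>

definition heavenly_coframe :: "(pt4 \<Rightarrow> complex) \<Rightarrow> coframe4" where
  "heavenly_coframe \<Theta> A A' m u =
     (if A = 0
      then (if A' = 0 then dy u + theta_xy \<Theta> m * dw u - theta_xx \<Theta> m * dz u else dw u)
      else (if A' = 0 then - dx u + theta_yy \<Theta> m * dw u - theta_xy \<Theta> m * dz u else dz u))"

lemma UNIV_2_01: "(UNIV :: 2 set) = {0, 1}"
  using UNIV_2 by auto

lemma heavenly_coframe_is_spin_coframe:
  "spin_coframe M (heavenly_metric \<Theta>) (heavenly_coframe \<Theta>)"
  by (simp add: spin_coframe_def heavenly_metric_def heavenly_coframe_def eps_def UNIV_2_01)
     (simp add: algebra_simps)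

definition hierarchy_slice :: "(nat \<Rightarrow> 'i::finite) \<Rightarrow> (complex ^ (2 \<times> 'i)) set
     \<Rightarrow> (complex ^ (2 \<times> 'i) \<Rightarrow> complex) \<Rightarrow> complex ^ (2 \<times> 'i) \<Rightarrow> pt4 set \<Rightarrow> metric4 \<Rightarrow> bool" where
  "hierarchy_slice lab N \<Theta> c M g \<longleftrightarrow> slice lab c ` M \<subseteq> N \<and>
     (\<forall>m\<in>M. g m = heavenly_metric (\<Theta> \<circ> slice lab c) m)"


section \<open>Twistor spaces and symmetries\<close>

text \<open>Over the disc of \<open>\<lambda>\<close> in question, twistor space has the inhomogeneous coordinates
  \<open>(\<omega>\<^sup>0 / \<pi>\<^sub>1'\<^sup>n, \<omega>\<^sup>1 / \<pi>\<^sub>1'\<^sup>n, \<lambda>)\<close>, and \<open>twistor_proj\<close> is the projection of the primed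
  spin bundle.\<close>

definition twistor_proj :: "nat \<Rightarrow> (2 \<Rightarrow> 'k::finite spin_pt \<Rightarrow> complex)
     \<Rightarrow> 'k spin_pt \<Rightarrow> complex ^ 3" where
  "twistor_proj n \<omega> z = (let \<pi> = snd z in
     vector [\<omega> 0 z / (\<pi> $ 1) ^ n, \<omega> 1 z / (\<pi> $ 1) ^ n, \<pi> $ 0 / \<pi> $ 1])"

text \<open>In these coordinates \<open>\<pi>\<^sub>A' d\<pi>\<^sup>A' = - \<pi>\<^sub>1'\<^sup>2 d\<lambda>\<close>, so
  \<open>\<nu>\<^sub>n = \<pi>\<^sub>1'\<^sup>2\<^sup>n\<^sup>+\<^sup>2 \<cdot> (- d\<zeta>\<^sup>0 \<and> d\<zeta>\<^sup>1 \<and> d\<lambda>)\<close>; \<open>nu_local\<close> is the form in brackets, i.e. \<open>\<nu>\<^sub>n\<close> in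
  the trivialisation of \<open>\<O>(2n+2)\<close> by \<open>\<pi>\<^sub>1'\<^sup>2\<^sup>n\<^sup>+\<^sup>2\<close>.\<close>

definition nu_local :: "complex ^ 3 \<Rightarrow> complex ^ 3 \<Rightarrow> complex ^ 3 \<Rightarrow> complex" where
  "nu_local a b c = - det (vector [a, b, c] :: complex ^ 3 ^ 3)"

text \<open>The map \<open>p : \<P>\<T>\<^sub>1 \<rightarrow> \<P>\<T>\<^sub>n\<close> of the iterated blow-up at \<open>\<lambda> = 0\<close>, in homogeneous terms
  \<open>\<omega>\<^sup>A = \<pi>\<^sub>0'\<^sup>n\<^sup>-\<^sup>1 \<omega>\<^sub>1\<^sup>A + \<Sum>\<^sub>i\<^sub>\<ge>\<^sub>2 \<pi>\<^sub>0'\<^sup>n\<^sup>-\<^sup>i \<pi>\<^sub>1'\<^sup>i c\<^sup>A\<^sup>i\<close>.\<close>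

definition blow_down :: "nat \<Rightarrow> (nat \<Rightarrow> 'i::finite) \<Rightarrow> complex ^ (2 \<times> 'i)
     \<Rightarrow> complex ^ 3 \<Rightarrow> complex ^ 3" where
  "blow_down n lab c Z =
     vector [(Z $ 3) ^ (n - 1) * Z $ 1 + (\<Sum>i=2..n. (Z $ 3) ^ (n - i) * c $ (0, lab i)),
             (Z $ 3) ^ (n - 1) * Z $ 2 + (\<Sum>i=2..n. (Z $ 3) ^ (n - i) * c $ (1, lab i)),
             Z $ 3]"

text \<open>The lift \<open>K + \<phi>\<^sup>A'\<^sub>B' \<pi>\<^sub>A' \<partial>/\<partial>\<pi>\<^sub>B'\<close> of a vector field \<open>K\<close>; \<open>\<Phi> x $ A' $ B'\<close> is
  \<open>\<phi>\<^sup>A'\<^sub>B'\<close>.\<close>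

definition lift :: "(complex ^ 'k \<Rightarrow> complex ^ 'k) \<Rightarrow> (complex ^ 'k \<Rightarrow> complex ^ 2 ^ 2)
     \<Rightarrow> 'k::finite spin_pt \<Rightarrow> 'k spin_pt" where
  "lift K \<Phi> z = (K (fst z), \<chi> B'. \<Sum>A'\<in>UNIV. \<Phi> (fst z) $ A' $ B' * snd z $ A')"

definition hierarchy_symmetry :: "(complex ^ 'k) set \<Rightarrow> real
     \<Rightarrow> (2 \<Rightarrow> 'k::finite spin_pt \<Rightarrow> complex)
     \<Rightarrow> (complex ^ 'k \<Rightarrow> complex ^ 'k) \<Rightarrow> (complex ^ 'k \<Rightarrow> complex ^ 2 ^ 2) \<Rightarrow> bool" where
  "hierarchy_symmetry N r \<omega> K \<Phi> \<longleftrightarrow>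
     (\<forall>a. holo (\<lambda>x. K x $ a) N) \<and> (\<forall>A' B'. holo (\<lambda>x. \<Phi> x $ A' $ B') N) \<and>
     (\<forall>z \<in> N \<times> pi_cone r. \<forall>X Y. lie_derivative2 (lift K \<Phi>) (fibre_form \<omega>) z X Y = 0)"

definition tri_holomorphic ::
  "(complex ^ 'k) set \<Rightarrow> (complex ^ 'k \<Rightarrow> complex ^ 2 ^ 2) \<Rightarrow> bool" where
  "tri_holomorphic N \<Phi> \<longleftrightarrow>
     (\<exists>\<mu>. \<forall>x\<in>N. \<forall>A' B'. \<Phi> x $ A' $ B' = (if A' = B' then \<mu> x else 0))"

definition killing :: "(complex ^ 'k) set \<Rightarrow> (complex ^ 'k \<Rightarrow> complex ^ 2 ^ 2) \<Rightarrow> bool" where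
  "killing N \<Phi> \<longleftrightarrow> (\<forall>x\<in>N. (\<Sum>A'\<in>UNIV. \<Phi> x $ A' $ A') = 0)"

text \<open>\<open>\<K>\<close> is the holomorphic vector field on twistor space to which the lift projects.\<close>

definition projects_to :: "nat \<Rightarrow> (complex ^ 'k) set \<Rightarrow> real
     \<Rightarrow> (2 \<Rightarrow> 'k::finite spin_pt \<Rightarrow> complex)
     \<Rightarrow> ('k spin_pt \<Rightarrow> 'k spin_pt)
     \<Rightarrow> (complex ^ 3 \<Rightarrow> complex ^ 3) \<Rightarrow> bool" where
  "projects_to n N r \<omega> X \<K> \<longleftrightarrow>
     (\<forall>a. holo (\<lambda>Z. \<K> Z $ a) (twistor_proj n \<omega> ` (N \<times> pi_cone r))) \<and>
     (\<forall>z \<in> N \<times> pi_cone r. D (twistor_proj n \<omega>) z (X z) = \<K> (twistor_proj n \<omega> z))"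

text \<open>The pullback of \<open>p\<^sup>*(\<K> \<lrcorner> \<nu>\<^sub>n)\<close> from \<open>\<P>\<T>\<^sub>1\<close> to the primed spin bundle, with its weight
  restored.\<close>

definition symmetry_form :: "nat \<Rightarrow> (nat \<Rightarrow> 'i::finite) \<Rightarrow> complex ^ (2 \<times> 'i)
     \<Rightarrow> (2 \<Rightarrow> (2 \<times> 2) spin_pt \<Rightarrow> complex) \<Rightarrow> (complex ^ 3 \<Rightarrow> complex ^ 3)
     \<Rightarrow> (2 \<times> 2) spin_pt \<Rightarrow> (2 \<times> 2) spin_pt \<Rightarrow> (2 \<times> 2) spin_pt \<Rightarrow> complex" where
  "symmetry_form n lab c \<omega>1 \<K> z X Y =
     (snd z $ 1) ^ (2 * n + 2) *
     pullback2 (twistor_proj 1 \<omega>1)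
       (pullback2 (blow_down n lab c) (\<lambda>Z. nu_local (\<K> Z))) z X Y"

text \<open>The 1-forms \<open>K\<^sup>A\<^sup>A\<^sub>1'\<^sup>\<dots> e\<^sub>A\<^sup>A\<^sub>2\<^sub>n' \<pi>\<^sub>A\<^sub>1' \<dots> \<pi>\<^sub>A\<^sub>2\<^sub>n'\<close> (with
  \<open>e\<^sub>A\<^sup>A' = e\<^sup>B\<^sup>A' \<epsilon>\<^sub>B\<^sub>A\<close>) and \<open>\<pi>\<^sub>B' d\<pi>\<^sup>B'\<close> on the primed spin bundle.\<close>

definition K_form :: "nat \<Rightarrow> coframe4 \<Rightarrow> (pt4 \<Rightarrow> 2 \<Rightarrow> 2 list \<Rightarrow> complex)
     \<Rightarrow> (2 \<times> 2) spin_pt \<Rightarrow> (2 \<times> 2) spin_pt \<Rightarrow> complex" where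
  "K_form n \<theta> K z X = (\<Sum>A\<in>UNIV. \<Sum>is\<in>idx_lists (2 * n - 1). \<Sum>A'\<in>UNIV.
     K (fst z) A is * (\<Sum>B\<in>UNIV. \<theta> B A' (fst z) (fst X) * eps B A)
       * spinor_power (snd z) is * snd z $ A')"

definition pi_dpi :: "(2 \<times> 2) spin_pt \<Rightarrow> (2 \<times> 2) spin_pt \<Rightarrow> complex" where
  "pi_dpi z X = (\<Sum>B'\<in>UNIV. snd z $ B' * raise (snd X) $ B')"

definition associated_spinors :: "nat \<Rightarrow> (nat \<Rightarrow> 'i::finite) \<Rightarrow> complex ^ (2 \<times> 'i) \<Rightarrow> pt4 set
     \<Rightarrow> coframe4 \<Rightarrow> real \<Rightarrow> (2 \<Rightarrow> (2 \<times> 2) spin_pt \<Rightarrow> complex) \<Rightarrow> (complex ^ 3 \<Rightarrow> complex ^ 3)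
     \<Rightarrow> (pt4 \<Rightarrow> 2 \<Rightarrow> 2 list \<Rightarrow> complex) \<Rightarrow> (pt4 \<Rightarrow> 2 list \<Rightarrow> complex) \<Rightarrow> bool" where
  "associated_spinors n lab c M \<theta> r \<omega>1 \<K> K X \<longleftrightarrow>
     (\<forall>A. spinor_field (2 * n - 1) M (\<lambda>m. K m A)) \<and> spinor_field (2 * n) M X \<and>
     (\<forall>z \<in> M \<times> pi_cone r. \<forall>U V.
        symmetry_form n lab c \<omega>1 \<K> z U V =
          wedge (K_form n \<theta> K z) (pi_dpi z) U V
          + (\<Sum>is\<in>idx_lists (2 * n). X (fst z) is * spinor_power (raise (snd z)) is)
            * fibre_form \<omega>1 z U V)"

end

theory Submission
  imports Defs "HOL-Complex_Analysis.Cauchy_Integral_Formula"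
begin

text \<open>
  Tri-holomorphicity and the Killing condition force \<open>\<Phi> = 0\<close>, so the lift of \<open>K\<close> has no component along
  \<open>\<pi>\<close> and \<open>\<K>\<close> none along \<open>\<lambda>\<close>.  Hence \<open>p\<^sup>*(\<K> \<lrcorner> \<nu>\<^sub>n)\<close> pulls back to
  \<open>(K \<lrcorner> \<Sigma>\<^sub>n) \<and> \<pi>\<^sub>B' d\<pi>\<^sup>B'\<close>, without a term in \<open>\<Sigma>\<^sub>1\<close>, which gives \<open>\<chi> = 0\<close>.  Comparing coefficients,
  the 1-form defined by the spinor field \<open>K\<close> is the restriction of \<open>K \<lrcorner> \<Sigma>\<^sub>n\<close> to the slice; it is
  closed for every \<open>\<pi>\<close> because \<open>\<Sigma>\<^sub>n\<close> is closed and invariant under \<open>K\<close>.  Being polynomial in \<open>\<pi>\<close>, it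
  has closed coefficients, and \<open>\<phi>\<close> consists of their potentials.  The equation for \<open>\<phi>\<close> involves no
  connection terms, since by the heavenly equation the heavenly coframe is parallel in its primed
  index.
\<close>

section \<open>Holomorphic functions of several variables\<close>

text \<open>\<open>holo\<close> asks only for a complex-linear derivative at each point, while the
  argument needs continuous first and symmetric second derivatives. Both come from one-variable
  Cauchy integrals along complex lines, with a kernel common to all functions, differentiated under
  the integral sign. The symmetry K need not be tangent to the slice, so its contraction with
  \<open>\<Sigma>\<^sub>n\<close> cannot be formed from the restriction of
  \<open>\<Sigma>\<^sub>n\<close>. Closedness is therefore proved on N x cone and only then pulled
  back, the slice acting on the free argument alone. Identities in \<pi> always become identities of
  spinors in the same way: \<pi> ranges over an open cone, and a symmetric form that vanishes there
  has zero coefficients. The potentials are line integrals from a star centre, whence the starlike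
  sets in the existence claim. Each is determined only up to a constant, so the choice has to be
  tied to the multiset of indices for \<phi> to come out symmetric.\<close>

lemma Cauchy_derivative_cis_integral:
  fixes g :: "complex \<Rightarrow> complex"
  assumes "open T" "cball 0 r \<subseteq> T" "0 < r" "g holomorphic_on T"
  shows "((\<lambda>t. g (of_real r * cis (2 * pi * t)) * (cis (- (2 * pi * t)) / of_real r))
    has_integral deriv g 0) {0..1}"
proof -
  have hol: "g holomorphic_on ball 0 r" "g holomorphic_on cball 0 r"
    using assms(2) by (auto intro!: holomorphic_on_subset[OF assms(4)])
  have "((\<lambda>u. g u / (u - 0) ^ Suc 1) has_contour_integral
      ((2 * pi * \<i>) / fact 1) * (deriv ^^ 1) g 0) (circlepath 0 r)"
    using hol \<open>0 < r\<close>
    by (intro Cauchy_has_contour_integral_higher_derivative_circlepath)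
       (auto intro: holomorphic_on_imp_continuous_on)
  then have "((\<lambda>t. g (circlepath 0 r t) / (circlepath 0 r t)\<^sup>2 *
      vector_derivative (circlepath 0 r) (at t within {0..1})) has_integral
      2 * pi * \<i> * deriv g 0) {0..1}"
    by (simp add: has_contour_integral_def power2_eq_square)
  then have "((\<lambda>t. (1 / (2 * pi * \<i>)) * (g (circlepath 0 r t) / (circlepath 0 r t)\<^sup>2 *
      vector_derivative (circlepath 0 r) (at t within {0..1}))) has_integral
      (1 / (2 * pi * \<i>)) * (2 * pi * \<i> * deriv g 0)) {0..1}"
    by (rule has_integral_mult_right)
  then have *: "((\<lambda>t. (1 / (2 * pi * \<i>)) * (g (circlepath 0 r t) / (circlepath 0 r t)\<^sup>2 *
      vector_derivative (circlepath 0 r) (at t within {0..1}))) has_integral deriv g 0) {0..1}"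
    by simp
  \<comment> \<open>On u = r e^(2 pi i t) the form du / (2 pi i u^2) becomes (e^(-2 pi i t) / r) dt,
    a kernel that does not depend on \<open>g\<close>.\<close>
  show ?thesis
  proof (rule has_integral_eq[OF _ *])
    fix t :: real assume t: "t \<in> {0..1}"
    have c: "circlepath 0 r t = of_real r * cis (2 * pi * t)"
      by (simp add: circlepath cis_conv_exp mult_ac)
    have v: "vector_derivative (circlepath 0 r) (at t within {0..1}) =
        2 * pi * \<i> * of_real r * cis (2 * pi * t)"
      using t by (simp add: vector_derivative_circlepath01 cis_conv_exp mult_ac)
    have "cis (2 * pi * t) \<noteq> 0" "cis (- (2 * pi * t)) = 1 / cis (2 * pi * t)"
      by (simp_all add: cis_divide[symmetric] flip: cis_inverse inverse_eq_divide)
    then show "1 / (2 * pi * \<i>) * (g (circlepath 0 r t) / (circlepath 0 r t)\<^sup>2 *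
        vector_derivative (circlepath 0 r) (at t within {0..1})) =
      g (of_real r * cis (2 * pi * t)) * (cis (- (2 * pi * t)) / of_real r)"
      unfolding c v using \<open>0 < r\<close> by (simp add: field_simps power2_eq_square)
  qed
qed

text \<open>The scalar multiplication is a parameter because two carriers occur: coordinate vectors
  for the base and pairs of vectors for the spin bundle. \<open>sc_of_real\<close> ties it to the
  real structure in which the derivatives are taken.\<close>

locale complex_structure =
  fixes sc :: "complex \<Rightarrow> 'a::euclidean_space \<Rightarrow> 'a"
  assumes bilin: "bounded_bilinear sc"
    and sc_of_real: "sc (of_real t) x = t *\<^sub>R x"
    and sc_sc: "sc a (sc b x) = sc (a * b) x"
begin

section \<open>Complex differentiability and its closure properties\<close>

definition cdiff :: "('a \<Rightarrow> complex) \<Rightarrow> 'a set \<Rightarrow> bool" where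
  "cdiff f S \<longleftrightarrow> (\<forall>x\<in>S. \<exists>f'. (f has_derivative f') (at x) \<and> (\<forall>a v. f' (sc a v) = a * f' v))"

lemma cdiffI:
  "(\<And>x. x \<in> S \<Longrightarrow> (f has_derivative f' x) (at x)) \<Longrightarrow>
    (\<And>x a v. x \<in> S \<Longrightarrow> f' x (sc a v) = a * f' x v) \<Longrightarrow> cdiff f S"
  unfolding cdiff_def by blast

lemma cdiffD:
  assumes "cdiff f S" "x \<in> S"
  shows "(f has_derivative D f x) (at x)" "D f x (sc a v) = a * D f x v"
proof -
  obtain f' where f': "(f has_derivative f') (at x)" "\<And>a v. f' (sc a v) = a * f' v"
    using assms unfolding cdiff_def by blast
  then have "D f x = f'" using frechet_derivative_at[OF f'(1)] by simp
  then show "(f has_derivative D f x) (at x)" "D f x (sc a v) = a * D f x v"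
    using f' by auto
qed

lemma cdiff_subset: "cdiff f S \<Longrightarrow> T \<subseteq> S \<Longrightarrow> cdiff f T"
  by (auto simp: cdiff_def)

lemma cdiff_const: "cdiff (\<lambda>x. k) S"
  by (rule cdiffI[where f' = "\<lambda>x v. 0"]) auto

lemma cdiff_add: "cdiff f S \<Longrightarrow> cdiff h S \<Longrightarrow> cdiff (\<lambda>x. f x + h x) S"
  by (rule cdiffI[where f' = "\<lambda>x v. D f x v + D h x v"])
     (auto simp: cdiffD algebra_simps intro!: derivative_intros cdiffD)

lemma cdiff_mult: "cdiff f S \<Longrightarrow> cdiff h S \<Longrightarrow> cdiff (\<lambda>x. f x * h x) S"
  by (rule cdiffI[where f' = "\<lambda>x v. f x * D h x v + D f x v * h x"])
     (rule has_derivative_mult, auto simp: cdiffD algebra_simps)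

lemma cdiff_minus: "cdiff f S \<Longrightarrow> cdiff (\<lambda>x. - f x) S"
  using cdiff_mult[OF cdiff_const[of "-1"], of f] by simp

lemma cdiff_diff: "cdiff f S \<Longrightarrow> cdiff h S \<Longrightarrow> cdiff (\<lambda>x. f x - h x) S"
  using cdiff_add[OF _ cdiff_minus, of f S h] by simp

lemma cdiff_sum: "(\<And>i. i \<in> I \<Longrightarrow> cdiff (f i) S) \<Longrightarrow> cdiff (\<lambda>x. \<Sum>i\<in>I. f i x) S"
  by (induction I rule: infinite_finite_induct) (auto intro!: cdiff_const cdiff_add)

lemma continuous_on_cdiff: "cdiff f S \<Longrightarrow> continuous_on S f"
  by (meson cdiffD(1) continuous_at_imp_continuous_on has_derivative_continuous)

text \<open>Cauchy's formula on the complex line through y in the direction u. The point is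
  uniformity: one radius serves all y near x and all f, so that both may vary under the integral
  sign.\<close>

lemma directional_derivative_integral:
  assumes "open S" "x \<in> S"
  obtains \<rho> r :: real where "\<rho> > 0" "r > 0" "ball x \<rho> \<subseteq> S"
    "\<And>y \<zeta>. y \<in> ball x \<rho> \<Longrightarrow> norm \<zeta> \<le> r \<Longrightarrow> y + sc \<zeta> u \<in> S"
    "\<And>f y. cdiff f S \<Longrightarrow> y \<in> ball x \<rho> \<Longrightarrow>
      ((\<lambda>t. f (y + sc (of_real r * cis (2 * pi * t)) u) * (cis (- (2 * pi * t)) / of_real r))
        has_integral D f y u) {0..1}"
proof -
  interpret sc: bounded_bilinear sc by (rule bilin)
  obtain e where e: "e > 0" "ball x e \<subseteq> S"
    using assms open_contains_ball by blast
  obtain B where B: "B > 0" "\<And>a v. norm (sc a v) \<le> norm a * norm v * B"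
    using sc.pos_bounded by blast
  \<comment> \<open>The summand 1 keeps k positive when u = 0. With r = e / (2 k) the circles stay
    within e / 2 of their centres, which themselves lie within e / 2 of x.\<close>
  define k where "k = norm u * B + 1"
  define r where "r = e / (2 * k)"
  have k: "k > 0" using B by (simp add: k_def add_nonneg_pos)
  have r: "r > 0" using k e by (simp add: r_def)
  have in_S: "y + sc \<zeta> u \<in> S" if y: "y \<in> ball x (e/2)" and z: "norm \<zeta> \<le> r" for y \<zeta>
  proof -
    have "norm (sc \<zeta> u) \<le> norm \<zeta> * (norm u * B)"
      using B(2)[of \<zeta> u] by (simp add: mult.assoc)
    also have "\<dots> \<le> r * k"
      using z k B r by (intro mult_mono) (auto simp: k_def)
    also have "\<dots> = e / 2" using k by (simp add: r_def)
    finally have "norm (sc \<zeta> u) \<le> e / 2" .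
    moreover have "dist x (y + sc \<zeta> u) \<le> dist x y + norm (sc \<zeta> u)"
      by (metis add_diff_cancel_left' dist_commute dist_norm dist_triangle)
    ultimately have "dist x (y + sc \<zeta> u) < e" using y by simp
    then show ?thesis using e by auto
  qed
  show thesis
  proof
    show "e / 2 > 0" "r > 0" using e r by auto
    show "ball x (e / 2) \<subseteq> S" using e by (auto simp: subset_eq)
    show "y + sc \<zeta> u \<in> S" if "y \<in> ball x (e/2)" "norm \<zeta> \<le> r" for y \<zeta>
      using in_S that .
  next
    fix f y assume f: "cdiff f S" and y: "y \<in> ball x (e/2)"
    let ?g = "\<lambda>\<zeta>. f (y + sc \<zeta> u)"
    define T where "T = (\<lambda>\<zeta>. y + sc \<zeta> u) -` S"
    have oT: "open T" unfolding T_def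
      by (rule open_vimage[OF \<open>open S\<close>]) (intro continuous_intros sc.continuous_on)
    have dg: "(?g has_field_derivative D f (y + sc \<zeta> u) u) (at \<zeta>)" if "\<zeta> \<in> T" for \<zeta>
    proof -
      have S: "y + sc \<zeta> u \<in> S" using that by (simp add: T_def)
      have 1: "((\<lambda>\<zeta>. y + sc \<zeta> u) has_derivative (\<lambda>a. 0 + sc a u)) (at \<zeta>)"
        by (intro has_derivative_add has_derivative_const
            bounded_linear.has_derivative[OF sc.bounded_linear_left] has_derivative_ident)
      have "(?g has_derivative (\<lambda>a. D f (y + sc \<zeta> u) (0 + sc a u))) (at \<zeta>)"
        by (rule has_derivative_compose[OF 1 cdiffD(1)[OF f S]])
      then show ?thesis
        using cdiffD(2)[OF f S] by (simp add: has_field_derivative_def mult.commute[of _ "D f _ _"])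
    qed
    have "((\<lambda>t. ?g (of_real r * cis (2 * pi * t)) * (cis (- (2 * pi * t)) / of_real r))
        has_integral deriv ?g 0) {0..1}"
    proof (rule Cauchy_derivative_cis_integral[OF oT _ r])
      show "cball 0 r \<subseteq> T" using in_S[OF y] by (auto simp: T_def)
      show "?g holomorphic_on T"
        using dg oT by (auto simp: holomorphic_on_open)
    qed
    moreover have "0 \<in> T" using in_S[OF y, of 0] r by (simp add: T_def)
    then have "deriv ?g 0 = D f y u"
      using dg[of 0] by (simp add: DERIV_imp_deriv sc.zero_left)
    ultimately show "((\<lambda>t. f (y + sc (of_real r * cis (2 * pi * t)) u) *
        (cis (- (2 * pi * t)) / of_real r)) has_integral D f y u) {0..1}" by simp
  qed
qed

text \<open>The Cauchy integral depends continuously on its centre. This supplies the continuity of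
  first derivatives that differentiation under the integral sign presupposes.\<close>

lemma cdiff_derivative_continuous:
  assumes "open S" "cdiff f S"
  shows "continuous_on S (\<lambda>x. D f x u)"
proof -
  interpret sc: bounded_bilinear sc by (rule bilin)
  have "continuous (at x) (\<lambda>x. D f x u)" if x: "x \<in> S" for x
  proof -
    obtain \<rho> r :: real where *: "\<rho> > 0" "r > 0" "ball x \<rho> \<subseteq> S"
      "\<And>y \<zeta>. y \<in> ball x \<rho> \<Longrightarrow> norm \<zeta> \<le> r \<Longrightarrow> y + sc \<zeta> u \<in> S"
      "\<And>f y. cdiff f S \<Longrightarrow> y \<in> ball x \<rho> \<Longrightarrow>
        ((\<lambda>t. f (y + sc (of_real r * cis (2 * pi * t)) u) * (cis (- (2 * pi * t)) / of_real r))
          has_integral D f y u) {0..1}"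
      by (rule directional_derivative_integral[OF assms(1) x, of u]) blast
    have "continuous_on (ball x \<rho>) (\<lambda>y. integral (cbox 0 1)
        (\<lambda>t. f (y + sc (of_real r * cis (2 * pi * t)) u) * (cis (- (2 * pi * t)) / of_real r)))"
      unfolding case_prod_unfold
      by (rule integral_continuous_on_param, unfold case_prod_unfold,
          intro continuous_intros continuous_on_compose2[OF continuous_on_cdiff[OF assms(2)]]
            sc.continuous_on)
         (use * in \<open>auto simp: norm_mult\<close>)
    then have "continuous_on (ball x \<rho>) (\<lambda>y. D f y u)"
      by (rule continuous_on_eq) (use integral_unique[OF *(5)[OF assms(2)]] in simp)
    then show ?thesis
      using \<open>\<rho> > 0\<close> by (auto simp: continuous_on_eq_continuous_at)
  qed
  then show ?thesis by (simp add: continuous_at_imp_continuous_on)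
qed

section \<open>Second derivatives\<close>

lemma bounded_linear_D: "cdiff f S \<Longrightarrow> x \<in> S \<Longrightarrow> bounded_linear (D f x)"
  using cdiffD(1) has_derivative_bounded_linear by blast

text \<open>Differentiating the Cauchy integral with respect to its centre moves the derivative onto
  f. The second claim keeps the curve and the kernel, which are shared by all h, so that the
  representation can also be applied to a directional derivative of f.\<close>

lemma
  assumes S: "open S" and f: "cdiff f S" and x: "x \<in> S"
  shows directional_derivative_has_derivative:
      "((\<lambda>x. D f x u) has_derivative (\<lambda>v. D (\<lambda>x. D f x u) x v)) (at x)"
    and directional_derivative_eq_integral:
      "\<exists>\<gamma> k. \<gamma> ` {0..1::real} \<subseteq> S \<and>
        (\<forall>h. cdiff h S \<longrightarrow> D h x u = integral {0..1} (\<lambda>t. h (\<gamma> t) * k t)) \<and>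
        (\<forall>v. D (\<lambda>x. D f x u) x v = integral {0..1} (\<lambda>t. D f (\<gamma> t) v * k t))"
proof -
  interpret sc: bounded_bilinear sc by (rule bilin)
  obtain \<rho> r :: real where *: "\<rho> > 0" "r > 0" "ball x \<rho> \<subseteq> S"
    "\<And>y \<zeta>. y \<in> ball x \<rho> \<Longrightarrow> norm \<zeta> \<le> r \<Longrightarrow> y + sc \<zeta> u \<in> S"
    "\<And>f y. cdiff f S \<Longrightarrow> y \<in> ball x \<rho> \<Longrightarrow>
      ((\<lambda>t. f (y + sc (of_real r * cis (2 * pi * t)) u) * (cis (- (2 * pi * t)) / of_real r))
        has_integral D f y u) {0..1}"
    by (rule directional_derivative_integral[OF S x, of u]) blast
  define p where "p t = sc (of_real r * cis (2 * pi * t)) u" for t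
  define k where "k t = cis (- (2 * pi * t)) / of_real r" for t
  have p: "y + p t \<in> S" if "y \<in> ball x \<rho>" for y t
    using * that by (auto simp: p_def norm_mult)
  have cp: "continuous_on T p" for T
    unfolding p_def by (intro continuous_intros sc.continuous_on)
  have ck: "continuous_on T k" for T
    unfolding k_def using \<open>r > 0\<close> by (intro continuous_intros) auto
  have int: "D h y u = integral {0..1} (\<lambda>t. h (y + p t) * k t)"
    if "cdiff h S" "y \<in> ball x \<rho>" for h y
    using integral_unique[OF *(5)[OF that]] by (simp add: p_def k_def)
  \<comment> \<open>The Leibniz rule wants a continuous family of bounded linear maps; continuity in
    operator norm is then checked on basis vectors.\<close>
  define fx where "fx y t = Blinfun (\<lambda>v. D f (y + p t) v * k t)" for y t
  have bl: "bounded_linear (\<lambda>v. D f (y + p t) v * k t)" if "y \<in> ball x \<rho>" for y t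
    by (rule bounded_linear_mult_const[OF bounded_linear_D[OF f p[OF that]]])
  have fx: "blinfun_apply (fx y t) = (\<lambda>v. D f (y + p t) v * k t)" if "y \<in> ball x \<rho>" for y t
    unfolding fx_def by (rule bounded_linear_Blinfun_apply[OF bl[OF that]])
  have x\<rho>: "x \<in> ball x \<rho>" using \<open>\<rho> > 0\<close> by simp
  have cfx: "continuous_on (ball x \<rho> \<times> cbox 0 1) (\<lambda>(y, t). fx y t)"
    unfolding case_prod_unfold
  proof (rule continuous_on_blinfun_componentwise)
    fix i :: 'a
    have "continuous_on (ball x \<rho> \<times> cbox 0 1) (\<lambda>z. D f (fst z + p (snd z)) i * k (snd z))"
      by (intro continuous_intros continuous_on_compose2[OF cdiff_derivative_continuous[OF S f]]
          continuous_on_compose2[OF cp] continuous_on_compose2[OF ck])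
         (use p in auto)
    then show "continuous_on (ball x \<rho> \<times> cbox 0 1) (\<lambda>z. blinfun_apply (fx (fst z) (snd z)) i)"
      by (rule continuous_on_eq) (auto simp: fx)
  qed
  have "((\<lambda>y. integral (cbox 0 1) (\<lambda>t. f (y + p t) * k t)) has_derivative
      blinfun_apply (integral (cbox 0 1) (fx x))) (at x within ball x \<rho>)"
  proof (rule leibniz_rule[OF _ _ cfx x\<rho> convex_ball])
    fix y t assume y: "y \<in> ball x \<rho>"
    have 1: "((\<lambda>y. y + p t) has_derivative (\<lambda>v. v)) (at y)"
      by (auto intro!: derivative_eq_intros)
    have "((\<lambda>y. f (y + p t) * k t) has_derivative (\<lambda>v. D f (y + p t) v * k t)) (at y)"
      by (intro has_derivative_mult_left has_derivative_compose[OF 1 cdiffD(1)[OF f p[OF y]]])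
    then show "((\<lambda>y. f (y + p t) * k t) has_derivative blinfun_apply (fx y t)) (at y within ball x \<rho>)"
      using fx[OF y] by (simp add: has_derivative_at_withinI)
  next
    fix y assume y: "y \<in> ball x \<rho>"
    show "(\<lambda>t. f (y + p t) * k t) integrable_on cbox 0 1"
      by (intro integrable_continuous continuous_intros cp ck
          continuous_on_compose2[OF continuous_on_cdiff[OF f]]) (use p[OF y] in auto)
  qed
  then have "((\<lambda>y. integral {0..1} (\<lambda>t. f (y + p t) * k t)) has_derivative
      blinfun_apply (integral (cbox 0 1) (fx x))) (at x)"
    using x\<rho> by (simp add: at_within_open[OF x\<rho> open_ball])
  then have der: "((\<lambda>y. D f y u) has_derivative blinfun_apply (integral (cbox 0 1) (fx x))) (at x)"
    by (rule has_derivative_transform_within_open[OF _ open_ball x\<rho>]) (use int[OF f] in simp)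
  then have eq: "D (\<lambda>x. D f x u) x = blinfun_apply (integral (cbox 0 1) (fx x))"
    using frechet_derivative_at[OF der] by simp
  with der show "((\<lambda>x. D f x u) has_derivative (\<lambda>v. D (\<lambda>x. D f x u) x v)) (at x)"
    by simp
  have "continuous_on (cbox 0 1) (fx x)"
    using continuous_on_compose2[OF cfx, of "cbox 0 1" "\<lambda>t. (x, t)"] x\<rho>
    by (auto simp: continuous_on_Pair image_subset_iff)
  then have ifx: "fx x integrable_on cbox 0 1"
    by (rule integrable_continuous)
  have D2: "D (\<lambda>x. D f x u) x v = integral {0..1} (\<lambda>t. D f (x + p t) v * k t)" for v
    using blinfun_apply_integral[OF ifx, of v] by (simp add: eq fx x\<rho> \<open>\<rho> > 0\<close>)
  show "\<exists>\<gamma> k. \<gamma> ` {0..1::real} \<subseteq> S \<and>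
        (\<forall>h. cdiff h S \<longrightarrow> D h x u = integral {0..1} (\<lambda>t. h (\<gamma> t) * k t)) \<and>
        (\<forall>v. D (\<lambda>x. D f x u) x v = integral {0..1} (\<lambda>t. D f (\<gamma> t) v * k t))"
    using p[OF x\<rho>] int[OF _ x\<rho>] D2
    by (intro exI[of _ "\<lambda>t. x + p t"] exI[of _ k])
       auto
qed

lemma cdiff_directional_derivative:
  assumes S: "open S" and f: "cdiff f S"
  shows "cdiff (\<lambda>x. D f x u) S"
proof (rule cdiffI)
  fix x assume x: "x \<in> S"
  show "((\<lambda>x. D f x u) has_derivative D (\<lambda>x. D f x u) x) (at x)"
    using directional_derivative_has_derivative[OF S f x] .
  obtain \<gamma> k where \<gamma>: "\<gamma> ` {0..1::real} \<subseteq> S"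
    and eq: "\<forall>v. D (\<lambda>x. D f x u) x v = integral {0..1} (\<lambda>t. D f (\<gamma> t) v * k t)"
    using directional_derivative_eq_integral[OF S f x, of u] by (elim exE conjE) (rule that)
  show "D (\<lambda>x. D f x u) x (sc a v) = a * D (\<lambda>x. D f x u) x v" for a v
  proof -
    have "D (\<lambda>x. D f x u) x (sc a v) = integral {0..1} (\<lambda>t. a * (D f (\<gamma> t) v * k t))"
      unfolding eq[rule_format] using \<gamma> by (intro integral_cong) (auto simp: cdiffD(2)[OF f] image_subset_iff)
    then show ?thesis by (simp add: eq)
  qed
qed

text \<open>Both sides are the integral of D f (\<gamma> t) v against k: the left one by
  differentiating under the integral sign, the right one by representing the function D f (.) v with
  the same kernel.\<close>

lemma directional_derivatives_commute:
  assumes S: "open S" and f: "cdiff f S" and x: "x \<in> S"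
  shows "D (\<lambda>x. D f x u) x v = D (\<lambda>x. D f x v) x u"
proof -
  obtain \<gamma> k where "\<forall>h. cdiff h S \<longrightarrow> D h x u = integral {0..1::real} (\<lambda>t. h (\<gamma> t) * k t)"
    and "\<forall>v. D (\<lambda>x. D f x u) x v = integral {0..1} (\<lambda>t. D f (\<gamma> t) v * k t)"
    using directional_derivative_eq_integral[OF S f x, of u] by (elim exE conjE) (rule that)
  with cdiff_directional_derivative[OF S f, of v] show ?thesis by simp
qed

text \<open>F(y) is the integral of \<beta> along the segment from the star centre a to y.
  Closedness turns the differentiated integrand into the t-derivative of t \<beta>(a + t (x - a)) v,
  which integrates to \<beta> x v.\<close>

lemma Poincare_starlike:
  assumes S: "open S" "starlike S"
    and \<beta>: "\<And>v. cdiff (\<lambda>x. \<beta> x v) S"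
    and lin: "\<And>x. x \<in> S \<Longrightarrow> linear (\<beta> x)"
    and closed: "\<And>x u v. x \<in> S \<Longrightarrow> D (\<lambda>x. \<beta> x v) x u = D (\<lambda>x. \<beta> x u) x v"
  obtains F where "\<And>x. x \<in> S \<Longrightarrow> (F has_derivative \<beta> x) (at x)"
proof -
  obtain a where a: "a \<in> S" "\<And>x. x \<in> S \<Longrightarrow> closed_segment a x \<subseteq> S"
    using S(2) by (auto simp: starlike_def)
  define p where "p y t = a + t *\<^sub>R (y - a)" for y t
  have p: "p y t \<in> S" if "y \<in> S" "t \<in> {0..1}" for y t
  proof -
    have "p y t \<in> closed_segment a y"
      using that by (auto simp: closed_segment_def p_def algebra_simps intro!: exI[of _ t])
    then show ?thesis using a(2)[OF that(1)] by auto
  qed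
  define F where "F y = integral (cbox 0 1) (\<lambda>t. \<beta> (p y t) (y - a))" for y
  \<comment> \<open>In \<beta> (p y t) (y - a) both arguments depend on y; expanding in a basis
    reduces the derivative to a product rule.\<close>
  have expand: "\<beta> z w = (\<Sum>i\<in>Basis. (w \<bullet> i) *\<^sub>R \<beta> z i)" if "z \<in> S" for z w
    by (subst euclidean_representation[of w, symmetric])
       (simp add: linear_sum[OF lin[OF that]] linear_scale[OF lin[OF that]])
  have "(F has_derivative \<beta> x) (at x)" if x: "x \<in> S" for x
  proof -
    obtain \<rho> where \<rho>: "\<rho> > 0" "ball x \<rho> \<subseteq> S"
      using S(1) x open_contains_ball by blast
    then have x\<rho>: "x \<in> ball x \<rho>" by simp
    have p\<rho>: "p y t \<in> S" if "y \<in> ball x \<rho>" "t \<in> {0..1}" for y t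
      using p that \<rho> by blast
    define G where "G y t v = (\<Sum>i\<in>Basis. ((y - a) \<bullet> i) *\<^sub>R D (\<lambda>x. \<beta> x i) (p y t) (t *\<^sub>R v)
      + (v \<bullet> i) *\<^sub>R \<beta> (p y t) i)" for y t v
    have derp: "((\<lambda>y. p y t) has_derivative (\<lambda>v. t *\<^sub>R v)) (at y)" for y t
      unfolding p_def by (auto intro!: derivative_eq_intros)
    have derG: "((\<lambda>y. \<beta> (p y t) (y - a)) has_derivative G y t) (at y)"
      if y: "y \<in> ball x \<rho>" and t: "t \<in> {0..1}" for y t
    proof -
      have "((\<lambda>y. \<beta> (p y t) i) has_derivative (\<lambda>v. D (\<lambda>x. \<beta> x i) (p y t) (t *\<^sub>R v))) (at y)" for i
        by (rule has_derivative_compose[OF derp cdiffD(1)[OF \<beta> p\<rho>[OF y t]]])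
      then have "((\<lambda>y. \<Sum>i\<in>Basis. ((y - a) \<bullet> i) *\<^sub>R \<beta> (p y t) i) has_derivative G y t) (at y)"
        unfolding G_def
        by (intro has_derivative_sum has_derivative_scaleR) (auto intro!: derivative_eq_intros)
      then show ?thesis
        by (rule has_derivative_transform_within_open[OF _ open_ball y])
           (use expand p\<rho>[OF _ t] in auto)
    qed
    have cp: "continuous_on T (\<lambda>z. p (fst z) (snd z))" for T
      unfolding p_def by (intro continuous_intros)
    have cG: "continuous_on (ball x \<rho> \<times> cbox 0 1) (\<lambda>z. G (fst z) (snd z) v)" for v
    proof -
      have "continuous_on (ball x \<rho> \<times> cbox 0 1) (\<lambda>z. \<Sum>i\<in>Basis.
          ((fst z - a) \<bullet> i) *\<^sub>R (snd z *\<^sub>R D (\<lambda>x. \<beta> x i) (p (fst z) (snd z)) v)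
          + (v \<bullet> i) *\<^sub>R \<beta> (p (fst z) (snd z)) i)"
        by (intro continuous_intros continuous_on_compose2[OF cdiff_derivative_continuous[OF S(1) \<beta>] cp]
            continuous_on_compose2[OF continuous_on_cdiff[OF \<beta>] cp])
           (use p\<rho> in auto)
      then show ?thesis
        by (rule continuous_on_eq)
           (auto simp: G_def linear_scale[OF bounded_linear.linear[OF bounded_linear_D[OF \<beta> p\<rho>]]])
    qed
    have blG: "blinfun_apply (Blinfun (G y t)) = G y t"
      if "y \<in> ball x \<rho>" "t \<in> {0..1}" for y t
      using bounded_linear_Blinfun_apply has_derivative_bounded_linear[OF derG[OF that]] by blast
    have cBG: "continuous_on (ball x \<rho> \<times> cbox 0 1) (\<lambda>(y, t). Blinfun (G y t))"
      unfolding case_prod_unfold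
      by (intro continuous_on_blinfun_componentwise continuous_on_eq[OF cG]) (auto simp: blG)
    have "(F has_derivative blinfun_apply (integral (cbox 0 1) (\<lambda>t. Blinfun (G x t))))
        (at x within ball x \<rho>)"
      unfolding F_def
    proof (rule leibniz_rule[OF _ _ cBG x\<rho> convex_ball])
      show "((\<lambda>y. \<beta> (p y t) (y - a)) has_derivative blinfun_apply (Blinfun (G y t)))
          (at y within ball x \<rho>)" if "y \<in> ball x \<rho>" "t \<in> cbox 0 1" for y t
        using derG[of y t] blG[of y t] that by (auto intro: has_derivative_at_withinI)
    next
      fix y assume y: "y \<in> ball x \<rho>"
      have "continuous_on {0..1} (\<lambda>t. p y t)"
        unfolding p_def by (intro continuous_intros)
      then have "continuous_on {0..1} (\<lambda>t. \<beta> (p y t) (y - a))"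
        by (rule continuous_on_compose2[OF continuous_on_cdiff[OF \<beta>]]) (use p\<rho>[OF y] in auto)
      then show "(\<lambda>t. \<beta> (p y t) (y - a)) integrable_on cbox 0 1"
        by (simp add: integrable_continuous_interval)
    qed
    moreover have "blinfun_apply (integral (cbox 0 1) (\<lambda>t. Blinfun (G x t))) v = \<beta> x v" for v
    proof -
      have "continuous_on (cbox 0 1) (\<lambda>t. Blinfun (G x t))"
        using continuous_on_compose2[OF cBG, of "cbox 0 1" "\<lambda>t. (x, t)"] x\<rho>
        by (auto simp: continuous_on_Pair image_subset_iff)
      then have "(\<lambda>t. Blinfun (G x t)) integrable_on cbox 0 1"
        by (rule integrable_continuous)
      then have "blinfun_apply (integral (cbox 0 1) (\<lambda>t. Blinfun (G x t))) v
          = integral (cbox 0 1) (\<lambda>t. blinfun_apply (Blinfun (G x t)) v)"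
        by (rule blinfun_apply_integral)
      also have "\<dots> = integral {0..1} (\<lambda>t. G x t v)"
        using blG[OF x\<rho>] by (auto intro!: integral_cong)
      also have "\<dots> = 1 *\<^sub>R \<beta> (p x 1) v - 0 *\<^sub>R \<beta> (p x 0) v"
      proof (rule integral_unique[OF fundamental_theorem_of_calculus])
        fix t :: real assume t: "t \<in> {0..1}"
        note pS = p\<rho>[OF x\<rho> t]
        note linD = bounded_linear.linear[OF bounded_linear_D[OF \<beta> pS]]
        have 1: "((\<lambda>t. p x t) has_derivative (\<lambda>h. h *\<^sub>R (x - a))) (at t)"
          unfolding p_def by (auto intro!: derivative_eq_intros)
        have "((\<lambda>t. t *\<^sub>R \<beta> (p x t) v) has_derivative
            (\<lambda>h. t *\<^sub>R D (\<lambda>x. \<beta> x v) (p x t) (h *\<^sub>R (x - a)) + h *\<^sub>R \<beta> (p x t) v)) (at t)"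
          by (intro has_derivative_scaleR has_derivative_ident
              has_derivative_compose[OF 1 cdiffD(1)[OF \<beta> pS]])
        moreover have "t *\<^sub>R D (\<lambda>x. \<beta> x v) (p x t) (h *\<^sub>R (x - a)) + h *\<^sub>R \<beta> (p x t) v
            = h *\<^sub>R G x t v" for h
        proof -
          have "G x t v = t *\<^sub>R (\<Sum>i\<in>Basis. ((x - a) \<bullet> i) *\<^sub>R D (\<lambda>x. \<beta> x i) (p x t) v)
              + \<beta> (p x t) v"
            by (simp add: G_def sum.distrib linear_scale[OF linD] scaleR_sum_right
                expand[OF pS, of v] mult.commute)
          \<comment> \<open>The one use of closedness: the differentiation is turned from v into the
            direction of the ray.\<close>
          also have "(\<Sum>i\<in>Basis. ((x - a) \<bullet> i) *\<^sub>R D (\<lambda>x. \<beta> x i) (p x t) v)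
              = (\<Sum>i\<in>Basis. ((x - a) \<bullet> i) *\<^sub>R D (\<lambda>x. \<beta> x v) (p x t) i)"
            by (simp add: closed[OF pS, of _ v])
          also have "\<dots> = D (\<lambda>x. \<beta> x v) (p x t) (\<Sum>i\<in>Basis. ((x - a) \<bullet> i) *\<^sub>R i)"
            by (simp add: linear_sum[OF linD] linear_scale[OF linD])
          also have "(\<Sum>i\<in>Basis. ((x - a) \<bullet> i) *\<^sub>R i) = x - a"
            by (rule euclidean_representation)
          finally show ?thesis
            by (simp add: linear_scale[OF linD] scaleR_add_right mult.commute)
        qed
        ultimately show "((\<lambda>t. t *\<^sub>R \<beta> (p x t) v) has_vector_derivative G x t v) (at t within {0..1})"
          by (simp add: has_vector_derivative_def has_derivative_at_withinI)
      qed simp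
      also have "\<dots> = \<beta> x v" by (simp add: p_def)
      finally show ?thesis .
    qed
    then have "blinfun_apply (integral (cbox 0 1) (\<lambda>t. Blinfun (G x t))) = \<beta> x"
      by (rule ext)
    ultimately show ?thesis
      by (simp only: at_within_open[OF x\<rho> open_ball])
  qed
  then show thesis by (rule that)
qed

section \<open>Moving vector fields\<close>

lemma linear_D:
  assumes "cdiff f S" "x \<in> S"
  shows "D f x (u + v) = D f x u + D f x v" "D f x (u - v) = D f x u - D f x v"
    "D f x (- v) = - D f x v" "D f x 0 = 0"
  using bounded_linear.linear[OF bounded_linear_D[OF assms]]
  by (simp_all add: linear_add linear_diff linear_neg linear_0)

text \<open>Holds without differentiability: \<open>frechet_derivative\<close> chooses a derivative,
  and both functions have the same candidates.\<close>

lemma D_cong_open: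
  assumes "open S" "x \<in> S" "\<And>y. y \<in> S \<Longrightarrow> f y = h y"
  shows "D f x = D h x"
proof -
  have "(f has_derivative f') (at x) \<longleftrightarrow> (h has_derivative f') (at x)" for f'
    using has_derivative_transform_within_open[OF _ assms(1,2), of f f' UNIV h]
      has_derivative_transform_within_open[OF _ assms(1,2), of h f' UNIV f] assms(3)
    by auto
  then show ?thesis by (simp add: frechet_derivative_def)
qed

text \<open>A product rule for D f applied to a moving vector; the sum over basis vectors separates
  the two ways in which z enters.\<close>

lemma has_derivative_D_vector_field:
  assumes S: "open S" and f: "cdiff f S" and z: "z \<in> S" and X: "(X has_derivative X') (at z)"
  shows "((\<lambda>z. D f z (X z)) has_derivative (\<lambda>u. D (\<lambda>y. D f y (X z)) z u + D f z (X' u))) (at z)"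
proof -
  have expand: "D f y w = (\<Sum>i\<in>Basis. (w \<bullet> i) *\<^sub>R D f y i)" if "y \<in> S" for y w
    using bounded_linear.linear[OF bounded_linear_D[OF f that]]
    by (subst euclidean_representation[of w, symmetric]) (simp add: linear_sum linear_scale)
  have "((\<lambda>y. \<Sum>i\<in>Basis. (X y \<bullet> i) *\<^sub>R D f y i) has_derivative
      (\<lambda>u. \<Sum>i\<in>Basis. (X z \<bullet> i) *\<^sub>R D (\<lambda>y. D f y i) z u + (X' u \<bullet> i) *\<^sub>R D f z i)) (at z)"
    by (intro has_derivative_sum has_derivative_scaleR has_derivative_inner_left X
        directional_derivative_has_derivative[OF S f z])
  then have "((\<lambda>y. D f y (X y)) has_derivative
      (\<lambda>u. \<Sum>i\<in>Basis. (X z \<bullet> i) *\<^sub>R D (\<lambda>y. D f y i) z u + (X' u \<bullet> i) *\<^sub>R D f z i)) (at z)"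
    by (rule has_derivative_transform_within_open[OF _ S z]) (simp add: expand flip: expand)
  moreover have "(\<Sum>i\<in>Basis. (X z \<bullet> i) *\<^sub>R D (\<lambda>y. D f y i) z u + (X' u \<bullet> i) *\<^sub>R D f z i)
      = D (\<lambda>y. D f y (X z)) z u + D f z (X' u)" for u
  proof -
    note lin = bounded_linear.linear[OF bounded_linear_D[OF cdiff_directional_derivative[OF S f] z]]
    \<comment> \<open>Here \<open>i\<close> is an inner direction. Commuting moves it outside, where
      linearity of the derivative applies, and commuting once more restores the wanted form.\<close>
    have "(\<Sum>i\<in>Basis. (X z \<bullet> i) *\<^sub>R D (\<lambda>y. D f y i) z u)
        = (\<Sum>i\<in>Basis. (X z \<bullet> i) *\<^sub>R D (\<lambda>y. D f y u) z i)"
      by (simp add: directional_derivatives_commute[OF S f z, of _ u])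
    also have "\<dots> = D (\<lambda>y. D f y u) z (\<Sum>i\<in>Basis. (X z \<bullet> i) *\<^sub>R i)"
      by (simp add: linear_sum[OF lin] linear_scale[OF lin])
    also have "\<dots> = D (\<lambda>y. D f y (X z)) z u"
      by (simp add: euclidean_representation directional_derivatives_commute[OF S f z, of _ u])
    finally show ?thesis by (simp add: sum.distrib flip: expand[OF z])
  qed
  ultimately show ?thesis by simp
qed

text \<open>Cartan's formula for the closed 2-form \<open>df \<and> dh\<close>.\<close>

lemma contraction_closed:
  assumes S: "open S" and f: "cdiff f S" and h: "cdiff h S" and z: "z \<in> S"
    and X: "(X has_derivative X') (at z)"
    and lie: "lie_derivative2 X (\<lambda>z. wedge (D f z) (D h z)) z u v = 0"
  shows "(\<lambda>z. wedge (D f z) (D h z) (X z) v) differentiable (at z)"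
    and "D (\<lambda>z. wedge (D f z) (D h z) (X z) v) z u = D (\<lambda>z. wedge (D f z) (D h z) (X z) u) z v"
proof -
  note dd = directional_derivative_has_derivative[OF S _ z]
  note dX = has_derivative_D_vector_field[OF S _ z X]
  have 1: "((\<lambda>z. wedge (D f z) (D h z) (X z) v) has_derivative (\<lambda>u.
      (D f z (X z) * D (\<lambda>y. D h y v) z u + (D (\<lambda>y. D f y (X z)) z u + D f z (X' u)) * D h z v)
      - (D f z v * (D (\<lambda>y. D h y (X z)) z u + D h z (X' u)) + D (\<lambda>y. D f y v) z u * D h z (X z))))
      (at z)" for v
    unfolding wedge_def
    by (intro has_derivative_diff has_derivative_mult dd dX f h)
  have 2: "((\<lambda>z. wedge (D f z) (D h z) u v) has_derivative (\<lambda>w.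
      (D f z u * D (\<lambda>y. D h y v) z w + D (\<lambda>y. D f y u) z w * D h z v)
      - (D f z v * D (\<lambda>y. D h y u) z w + D (\<lambda>y. D f y v) z w * D h z u))) (at z)"
    unfolding wedge_def
    by (intro has_derivative_diff has_derivative_mult dd f h)
  show "(\<lambda>z. wedge (D f z) (D h z) (X z) v) differentiable (at z)"
    using 1 differentiable_def by blast
  have X': "D X z = X'" using frechet_derivative_at[OF X] by simp
  note comm = directional_derivatives_commute[OF S _ z]
  \<comment> \<open>Once mixed second derivatives are put in a common order, the expanded Lie
    derivative is the difference of the two sides. That reordering is where d(df \<and> dh) = 0
    enters.\<close>
  show "D (\<lambda>z. wedge (D f z) (D h z) (X z) v) z u = D (\<lambda>z. wedge (D f z) (D h z) (X z) u) z v"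
    using lie
    unfolding lie_derivative2_def X' frechet_derivative_at[OF 1, symmetric] frechet_derivative_at[OF 2, symmetric]
    unfolding wedge_def comm[OF f, of "X z"] comm[OF h, of "X z"] comm[OF f, of v u] comm[OF h, of v u]
    by (simp add: algebra_simps)
qed

end

section \<open>The two instances: coordinate spaces and spin bundles\<close>

lemma bounded_bilinear_vector_scalar: "bounded_bilinear ((*s) :: complex \<Rightarrow> _ \<Rightarrow> complex ^ 'k)"
proof
  show "\<exists>K. \<forall>a (b :: complex ^ 'k). norm (a *s b) \<le> norm a * norm b * K"
  proof (intro exI[of _ 1] allI)
    fix a and b :: "complex ^ 'k"
    have "norm (a *s b) = norm a * norm b"
      by (simp add: norm_vec_def L2_set_def norm_mult power_mult_distrib real_sqrt_mult
          flip: sum_distrib_left)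
    then show "norm (a *s b) \<le> norm a * norm b * 1" by simp
  qed
qed (auto simp: vec_eq_iff algebra_simps)

interpretation vec: complex_structure "(*s) :: complex \<Rightarrow> complex ^ 'k \<Rightarrow> complex ^ 'k"
  by (rule complex_structure.intro)
     (auto simp: bounded_bilinear_vector_scalar vec_eq_iff scaleR_conv_of_real[where 'a = complex])

interpretation pair: complex_structure
  "\<lambda>a z. (a *s fst z, a *s snd z) :: (complex ^ 'k) \<times> (complex ^ 'l)"
proof (rule complex_structure.intro)
  interpret s: bounded_bilinear "(*s) :: complex \<Rightarrow> _ \<Rightarrow> complex ^ 'k"
    by (rule bounded_bilinear_vector_scalar)
  interpret t: bounded_bilinear "(*s) :: complex \<Rightarrow> _ \<Rightarrow> complex ^ 'l"
    by (rule bounded_bilinear_vector_scalar)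
  show "bounded_bilinear (\<lambda>a z. (a *s fst z, a *s snd z) :: (complex ^ 'k) \<times> (complex ^ 'l))"
  proof
    obtain A where A: "\<And>a b. norm (a *s b :: complex ^ 'k) \<le> norm a * norm b * A" "A \<ge> 0"
      using s.nonneg_bounded by blast
    obtain B where B: "\<And>a b. norm (a *s b :: complex ^ 'l) \<le> norm a * norm b * B" "B \<ge> 0"
      using t.nonneg_bounded by blast
    show "\<exists>K. \<forall>a (b :: (complex ^ 'k) \<times> (complex ^ 'l)).
        norm (a *s fst b, a *s snd b) \<le> norm a * norm b * K"
    proof (intro exI[of _ "A + B"] allI)
      fix a and b :: "(complex ^ 'k) \<times> (complex ^ 'l)"
      have "norm (a *s fst b, a *s snd b) \<le> norm (a *s fst b) + norm (a *s snd b)"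
        by (rule norm_Pair_le)
      also have "\<dots> \<le> norm a * norm (fst b) * A + norm a * norm (snd b) * B"
        by (intro add_mono A B)
      also have "\<dots> \<le> norm a * norm b * A + norm a * norm b * B"
        using norm_fst_le[of "fst b" "snd b"] norm_snd_le[of "snd b" "fst b"] A(2) B(2)
        by (intro add_mono mult_right_mono mult_left_mono) auto
      finally show "norm (a *s fst b, a *s snd b) \<le> norm a * norm b * (A + B)"
        by (simp add: algebra_simps)
    qed
  qed (auto simp: vec_eq_iff algebra_simps)
qed (auto simp: vec_eq_iff scaleR_conv_of_real[where 'a = complex] scaleR_prod_def)

lemma holo_iff_cdiff: "holo f S \<longleftrightarrow> vec.cdiff f S"
  by (simp add: holo_def vec.cdiff_def)

lemma holo_pair_iff_cdiff: "holo_pair f S \<longleftrightarrow> pair.cdiff f S"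
  by (simp add: holo_pair_def pair.cdiff_def)

section \<open>Symmetric forms\<close>

lemma exhaust_2_01: "i = 0 \<or> i = 1" for i :: 2
  using UNIV_2_01 by auto

lemma finite_idx_lists [simp]: "finite (idx_lists k)"
  using finite_lists_length_eq[of "UNIV :: 2 set" k] by (simp add: idx_lists_def)

lemma idx_lists_0: "idx_lists 0 = {[]}"
  by (auto simp: idx_lists_def)

text \<open>The last index is split off, not the first, to match \<open>butlast\<close> and
  \<open>last\<close> in the equation for \<phi>.\<close>

lemma sum_idx_lists_Suc:
  "(\<Sum>is\<in>idx_lists (Suc k). f is) = (\<Sum>js\<in>idx_lists k. \<Sum>j\<in>UNIV. f (js @ [j]))"
proof -
  have "bij_betw (\<lambda>(js, j). js @ [j]) (idx_lists k \<times> UNIV) (idx_lists (Suc k))"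
    by (rule bij_betw_byWitness[where f' = "\<lambda>is. (butlast is, last is)"])
       (auto simp: idx_lists_def simp flip: length_0_conv)
  from sum.reindex_bij_betw[OF this, of f] show ?thesis
    by (simp add: sum.cartesian_product case_prod_unfold)
qed

lemma spinor_power_snoc: "spinor_power \<rho> (is @ [i]) = spinor_power \<rho> is * \<rho> $ i"
  by (simp add: spinor_power_def nth_append)

lemma spinor_power_mset: "spinor_power \<rho> is = (\<Prod>i\<in>#mset is. \<rho> $ i)"
  by (induction "is" rule: rev_induct) (auto simp: spinor_power_snoc spinor_power_def[of _ "[]"])

lemma symmetrise_mset_cong:
  assumes "mset js = mset is"
  shows "symmetrise T js = symmetrise T is"
proof -
  obtain p where p: "p permutes {..<length is}" "permute_list p is = js"
    using mset_eq_permutation[OF assms] by blast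
  have len: "length js = length is" using assms mset_eq_length by blast
  have "(\<Sum>\<sigma> | \<sigma> permutes {..<length is}. T (permute_list \<sigma> js))
      = (\<Sum>\<sigma> | \<sigma> permutes {..<length is}. T (permute_list (p \<circ> \<sigma>) is))"
    using p by (intro sum.cong) (auto simp: permute_list_compose)
  also have "\<dots> = (\<Sum>\<sigma> | \<sigma> permutes {..<length is}. T (permute_list \<sigma> is))"
    using setum_permutations_compose_left[OF p(1), of "\<lambda>\<sigma>. T (permute_list \<sigma> is)"] by simp
  finally show ?thesis by (simp add: symmetrise_def len)
qed

text \<open>Each permutation only relabels the lists summed over and leaves c unchanged, so all
  terms of the average agree. Hence contraction with powers of a single spinor does not see the
  symmetrisation.\<close>

lemma sum_symmetrise_mult:
  assumes c: "\<And>is js. mset js = mset is \<Longrightarrow> c js = c is"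
  shows "(\<Sum>is\<in>idx_lists k. symmetrise T is * c is) = (\<Sum>is\<in>idx_lists k. T is * c is)"
proof -
  let ?P = "{\<sigma>. \<sigma> permutes {..<k}}"
  have perm: "(\<Sum>is\<in>idx_lists k. T (permute_list \<sigma> is) * c is) = (\<Sum>is\<in>idx_lists k. T is * c is)"
    if s: "\<sigma> permutes {..<k}" for \<sigma>
  proof -
    have "bij_betw (permute_list \<sigma>) (idx_lists k) (idx_lists k)"
    proof (rule bij_betw_byWitness[where f' = "permute_list (inv \<sigma>)"])
      have *: "permute_list (inv \<sigma>) (permute_list \<sigma> is) = is"
        "permute_list \<sigma> (permute_list (inv \<sigma>) is) = is" if "is \<in> idx_lists k" for "is"
        using that s permutes_inv[OF s] permute_list_compose[of "inv \<sigma>" "is" \<sigma>]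
          permute_list_compose[of \<sigma> "is" "inv \<sigma>"]
        by (auto simp: idx_lists_def permutes_inv_o[OF s])
      then show "\<forall>a\<in>idx_lists k. permute_list (inv \<sigma>) (permute_list \<sigma> a) = a"
        "\<forall>a\<in>idx_lists k. permute_list \<sigma> (permute_list (inv \<sigma>) a) = a" by auto
    qed (auto simp: idx_lists_def)
    from sum.reindex_bij_betw[OF this, of "\<lambda>is. T is * c is"]
    have "(\<Sum>is\<in>idx_lists k. T (permute_list \<sigma> is) * c (permute_list \<sigma> is))
        = (\<Sum>is\<in>idx_lists k. T is * c is)" .
    moreover have "c (permute_list \<sigma> is) = c is" if "is \<in> idx_lists k" for "is"
      using that s by (intro c) (auto simp: idx_lists_def)
    ultimately show ?thesis by simp
  qed
  have "(\<Sum>is\<in>idx_lists k. symmetrise T is * c is)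
      = (\<Sum>is\<in>idx_lists k. (\<Sum>\<sigma>\<in>?P. T (permute_list \<sigma> is) * c is)) / fact k"
    unfolding sum_divide_distrib
    by (intro sum.cong) (auto simp: symmetrise_def idx_lists_def sum_distrib_right sum_divide_distrib)
  also have "\<dots> = (\<Sum>\<sigma>\<in>?P. \<Sum>is\<in>idx_lists k. T (permute_list \<sigma> is) * c is) / fact k"
    by (subst sum.swap) simp
  also have "\<dots> = (\<Sum>\<sigma>\<in>?P. \<Sum>is\<in>idx_lists k. T is * c is) / fact k"
    by (intro arg_cong2[where f = "(/)"] sum.cong refl perm) auto
  also have "\<dots> = (\<Sum>is\<in>idx_lists k. T is * c is)"
    by (simp add: card_permutations[OF refl, of "{..<k}"])
  finally show ?thesis .
qed

lemma mset_eq_idx_lists_iff: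
  assumes "is \<in> idx_lists k" "js \<in> idx_lists k" "count_list js 1 = count_list is 1"
  shows "mset js = mset is"
proof -
  have len: "count_list ks 0 + count_list ks 1 = length ks" for ks :: "2 list"
    using sum_count_set[OF subset_UNIV finite, of ks] by (simp add: UNIV_2_01)
  have "count_list js i = count_list is i" for i
    using len[of js] len[of "is"] assms exhaust_2_01[of i] by (auto simp: idx_lists_def)
  then show ?thesis by (simp add: multiset_eq_iff count_mset)
qed

text \<open>On \<open>\<rho> = (1, s)\<close> the form becomes a polynomial in \<open>s\<close> whose \<open>j\<close>-th coefficient is a positive
  multiple of the value of \<open>c\<close> at the lists with \<open>j\<close> ones.\<close>

lemma symmetric_form_eq_0:
  fixes c :: "2 list \<Rightarrow> complex"
  assumes c: "\<And>is js. is \<in> idx_lists k \<Longrightarrow> mset js = mset is \<Longrightarrow> c js = c is"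
    and r: "r > 0"
    and 0: "\<And>\<rho>. \<rho> $ 0 = 1 \<Longrightarrow> norm (\<rho> $ 1) < r \<Longrightarrow>
      (\<Sum>is\<in>idx_lists k. c is * spinor_power \<rho> is) = 0"
    and "is": "is \<in> idx_lists k"
  shows "c is = 0"
proof -
  define L where "L j = {js \<in> idx_lists k. count_list js 1 = j}" for j
  have finL: "finite (L j)" for j by (simp add: L_def)
  have poly: "(\<Sum>j\<le>k. (\<Sum>js\<in>L j. c js) * s ^ j) = 0" if s: "norm s < r" for s
  proof -
    define \<rho> :: "complex ^ 2" where "\<rho> = (\<chi> i. if i = 0 then 1 else s)"
    have \<rho>: "\<rho> $ 0 = 1" "\<rho> $ 1 = s" by (auto simp: \<rho>_def)
    have sp: "spinor_power \<rho> js = s ^ count_list js 1" for js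
    proof (induction js rule: rev_induct)
      case (snoc j js)
      then show ?case using exhaust_2_01[of j] by (auto simp: spinor_power_snoc \<rho>_def)
    qed (simp add: spinor_power_def)
    have "(\<Sum>j\<le>k. (\<Sum>js\<in>L j. c js) * s ^ j) = (\<Sum>j\<le>k. \<Sum>js\<in>L j. c js * spinor_power \<rho> js)"
      by (auto simp: sum_distrib_right sp L_def intro!: sum.cong)
    also have "\<dots> = (\<Sum>js\<in>idx_lists k. c js * spinor_power \<rho> js)"
      unfolding L_def
      by (rule sum.group) (simp_all, auto simp: idx_lists_def count_le_length)
    also have "\<dots> = 0" using 0 \<rho> s by simp
    finally show ?thesis .
  qed
  have "(\<Sum>js\<in>L j. c js) = 0" if "j \<le> k" for j
  proof (rule ccontr)
    assume "(\<Sum>js\<in>L j. c js) \<noteq> 0"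
    with \<open>j \<le> k\<close> have "finite {s. (\<Sum>j\<le>k. (\<Sum>js\<in>L j. c js) * s ^ j) = 0}"
      by (rule polyfun_roots_finite[rotated])
    then have "finite (ball (0::complex) r)"
      by (rule finite_subset[rotated]) (use poly in auto)
    then show False using r finite_imp_not_open[OF _ open_ball] by fastforce
  qed
  moreover define j where "j = count_list is 1"
  moreover have "j \<le> k" using "is" count_le_length[of "is" 1] by (auto simp: j_def idx_lists_def)
  moreover have "(\<Sum>js\<in>L j. c js) = of_nat (card (L j)) * c is"
    using c[OF "is" mset_eq_idx_lists_iff[OF "is"]] by (simp add: L_def j_def)
  moreover have "is \<in> L j" using "is" by (simp add: L_def j_def)
  ultimately show ?thesis using finL[of j] by auto
qed

section \<open>Raising and lowering indices\<close>

lemma sum_prod_idx_lists: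
  fixes f :: "2 \<Rightarrow> 2 \<Rightarrow> complex"
  shows "(\<Sum>ks\<in>idx_lists (length js). \<Prod>k<length js. f (js ! k) (ks ! k))
    = (\<Prod>k<length js. \<Sum>l\<in>UNIV. f (js ! k) l)"
proof (induction js rule: rev_induct)
  case Nil
  then show ?case by (simp add: idx_lists_0)
next
  case (snoc j js)
  have "(\<Sum>ks\<in>idx_lists (length (js @ [j])). \<Prod>k<length (js @ [j]). f ((js @ [j]) ! k) (ks ! k))
      = (\<Sum>ks\<in>idx_lists (length js). \<Sum>l\<in>UNIV. (\<Prod>k<length js. f (js ! k) (ks ! k)) * f j l)"
    unfolding length_append_singleton sum_idx_lists_Suc
    by (intro sum.cong refl) (auto simp: nth_append idx_lists_def)
  also have "\<dots> = (\<Prod>k<length js. \<Sum>l\<in>UNIV. f (js ! k) l) * (\<Sum>l\<in>UNIV. f j l)"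
    by (simp add: snoc.IH[symmetric] sum_product)
  finally show ?case by (simp add: nth_append)
qed

lemma eps_raise:
  "(\<Sum>l\<in>UNIV. eps j l * raise \<pi> $ l) = - \<pi> $ j"
  "(\<Sum>l\<in>UNIV. eps l j * raise \<pi> $ l) = \<pi> $ j"
  using exhaust_2_01[of j] by (auto simp: UNIV_2_01 eps_def raise_def)

text \<open>A see-saw: contracting a lowered index with the raised \<pi> is minus contracting the
  original index with \<pi>, and this happens once for each of the k primed indices.\<close>

lemma lower_all_spinor_power_raise:
  "(\<Sum>ks\<in>idx_lists k. lower_all T A ks * spinor_power (raise \<pi>) ks)
    = (- 1) ^ k * (\<Sum>B\<in>UNIV. \<Sum>js\<in>idx_lists k. T B js * eps B A * spinor_power \<pi> js)"
proof -
  have "(\<Sum>ks\<in>idx_lists k. lower_all T A ks * spinor_power (raise \<pi>) ks)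
      = (\<Sum>ks\<in>idx_lists k. \<Sum>B\<in>UNIV. \<Sum>js\<in>idx_lists k. T B js * eps B A *
          (\<Prod>l<length js. eps (js ! l) (ks ! l) * raise \<pi> $ (ks ! l)))"
    by (auto simp: lower_all_def idx_lists_def spinor_power_def sum_distrib_left sum_distrib_right
        prod.distrib mult_ac intro!: sum.cong)
  also have "\<dots> = (\<Sum>B\<in>UNIV. \<Sum>js\<in>idx_lists k. \<Sum>ks\<in>idx_lists k. T B js * eps B A *
          (\<Prod>l<length js. eps (js ! l) (ks ! l) * raise \<pi> $ (ks ! l)))"
    by (subst sum.swap, rule sum.cong[OF refl], rule sum.swap)
  also have "\<dots> = (\<Sum>B\<in>UNIV. \<Sum>js\<in>idx_lists k. T B js * eps B A * ((- 1) ^ k * spinor_power \<pi> js))"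
  proof (intro sum.cong refl)
    fix B js assume js: "js \<in> idx_lists k"
    have "(\<Sum>ks\<in>idx_lists (length js). \<Prod>l<length js. eps (js ! l) (ks ! l) * raise \<pi> $ (ks ! l))
        = (\<Prod>l<length js. - \<pi> $ (js ! l))"
      using sum_prod_idx_lists[of "\<lambda>j l. eps j l * raise \<pi> $ l" js] by (simp add: eps_raise)
    also have "\<dots> = (- 1) ^ k * spinor_power \<pi> js"
      using js by (simp add: prod_uminus idx_lists_def spinor_power_def)
    finally show "(\<Sum>ks\<in>idx_lists k. T B js * eps B A *
        (\<Prod>l<length js. eps (js ! l) (ks ! l) * raise \<pi> $ (ks ! l)))
      = T B js * eps B A * ((- 1) ^ k * spinor_power \<pi> js)"
      using js by (simp add: idx_lists_def flip: sum_distrib_left)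
  qed
  finally show ?thesis by (simp add: sum_distrib_left mult_ac)
qed

text \<open>If \<open>e A A'\<close> is \<open>e\<^sup>A\<^sup>A'(u)\<close>, then \<open>potential_form e K is\<close> is the value at \<open>u\<close> that the equation
  prescribes for the differential of \<open>\<phi>\<^sub>i\<^sub>s\<close>.\<close>

definition potential_form ::
  "(2 \<Rightarrow> 2 \<Rightarrow> complex) \<Rightarrow> (2 \<Rightarrow> 2 list \<Rightarrow> complex) \<Rightarrow> 2 list \<Rightarrow> complex" where
  "potential_form e T = symmetrise (\<lambda>js. \<Sum>A\<in>UNIV. \<Sum>A'\<in>UNIV.
     e A A' * (lower_all T A (butlast js) * eps (last js) A'))"

text \<open>The 1-form that defines the spinor field is thereby the generating polynomial of what
  the equation prescribes for d\<phi>. Two signs cancel: an odd number 2n - 1 of primed indices is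
  lowered, and the unprimed contraction uses \<open>eps\<close> with its slots exchanged.\<close>

lemma K_form_eq_potential_form:
  assumes "n \<ge> 1"
  shows "K_form n \<theta> K (m, \<pi>) (u, \<rho>) =
    (\<Sum>is\<in>idx_lists (2 * n). potential_form (\<lambda>A A'. \<theta> A A' m u) (K m) is * spinor_power (raise \<pi>) is)"
proof -
  define k where "k = 2 * n - 1"
  have k: "2 * n = Suc k" "odd k" using assms by (auto simp: k_def)
  let ?e = "\<lambda>A A'. \<theta> A A' m u"
  have "(\<Sum>is\<in>idx_lists (2 * n). potential_form ?e (K m) is * spinor_power (raise \<pi>) is)
      = (\<Sum>js\<in>idx_lists k. \<Sum>j\<in>UNIV. (\<Sum>A\<in>UNIV. \<Sum>A'\<in>UNIV.
          ?e A A' * (lower_all (K m) A js * eps j A')) * (spinor_power (raise \<pi>) js * raise \<pi> $ j))"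
    unfolding potential_form_def
    by (subst sum_symmetrise_mult)
       (simp_all only: spinor_power_mset[of _ "_ :: 2 list", symmetric] k(1) sum_idx_lists_Suc
         butlast_snoc last_snoc spinor_power_snoc, simp add: spinor_power_mset)
  also have "\<dots> = (\<Sum>js\<in>idx_lists k. \<Sum>A\<in>UNIV. \<Sum>A'\<in>UNIV. ?e A A' *
      (lower_all (K m) A js * spinor_power (raise \<pi>) js) * (\<Sum>j\<in>UNIV. eps j A' * raise \<pi> $ j))"
    by (rule sum.cong[OF refl]) (simp add: UNIV_2_01 algebra_simps)
  also have "\<dots> = (\<Sum>A\<in>UNIV. \<Sum>A'\<in>UNIV. ?e A A' * \<pi> $ A' *
      (\<Sum>js\<in>idx_lists k. lower_all (K m) A js * spinor_power (raise \<pi>) js))"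
    unfolding eps_raise by (simp add: UNIV_2_01 sum.distrib sum_distrib_left algebra_simps)
  also have "\<dots> = (\<Sum>A\<in>UNIV. \<Sum>A'\<in>UNIV. ?e A A' * \<pi> $ A' *
      - (\<Sum>B\<in>UNIV. \<Sum>js\<in>idx_lists k. K m B js * eps B A * spinor_power \<pi> js))"
    unfolding lower_all_spinor_power_raise using k by simp
  also have "\<dots> = K_form n \<theta> K (m, \<pi>) (u, \<rho>)"
    unfolding K_form_def k_def[symmetric]
    by (simp add: UNIV_2_01 eps_def sum.distrib sum_distrib_left sum_negf algebra_simps)
  finally show ?thesis ..
qed

text \<open>The spinors (1, s) of \<open>symmetric_form_eq_0\<close> are \<open>raise \<pi>\<close>
  for \<pi> = (-s, 1), so small s corresponds to \<pi> near the axis of the cone.\<close>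

lemma symmetric_form_cone_eq_0:
  fixes c :: "2 list \<Rightarrow> complex"
  assumes "\<And>is js. is \<in> idx_lists k \<Longrightarrow> mset js = mset is \<Longrightarrow> c js = c is"
    and "\<delta> > 0"
    and 0: "\<And>\<pi>. \<pi> $ 1 = 1 \<Longrightarrow> norm (\<pi> $ 0) < \<delta> \<Longrightarrow>
      (\<Sum>is\<in>idx_lists k. c is * spinor_power (raise \<pi>) is) = 0"
    and "is \<in> idx_lists k"
  shows "c is = 0"
proof (rule symmetric_form_eq_0[OF assms(1,2) _ assms(4)])
  fix \<rho> :: "complex ^ 2" assume \<rho>: "\<rho> $ 0 = 1" "norm (\<rho> $ 1) < \<delta>"
  define \<pi> :: "complex ^ 2" where "\<pi> = (\<chi> i. if i = 0 then - \<rho> $ 1 else 1)"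
  have "raise \<pi> $ i = \<rho> $ i" for i
    using exhaust_2_01[of i] \<rho>(1) by (auto simp: \<pi>_def raise_def eps_def UNIV_2_01)
  then have "raise \<pi> = \<rho>" by (simp add: vec_eq_iff)
  with 0[of \<pi>] \<rho> show "(\<Sum>is\<in>idx_lists k. c is * spinor_power \<rho> is) = 0"
    by (simp add: \<pi>_def)
qed auto

text \<open>The components of \<open>potential_form\<close> along the coframe; at T =
  \<open>K_spinor m\<close> this is the right-hand side of the equation for \<phi>.\<close>

definition potential_coeff :: "(2 \<Rightarrow> 2 list \<Rightarrow> complex) \<Rightarrow> 2 \<Rightarrow> 2 \<Rightarrow> 2 list \<Rightarrow> complex" where
  "potential_coeff T A A' = symmetrise (\<lambda>js. lower_all T A (butlast js) * eps (last js) A')"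

lemma potential_form_eq:
  "potential_form e T is = (\<Sum>A\<in>UNIV. \<Sum>A'\<in>UNIV. e A A' * potential_coeff T A A' is)"
  by (simp add: potential_form_def potential_coeff_def symmetrise_def UNIV_2_01 sum.distrib
      sum_distrib_left add_divide_distrib)

lemma cdiff_potential_coeff:
  assumes T: "\<And>A js. js \<in> idx_lists (k - 1) \<Longrightarrow> vec.cdiff (\<lambda>m. T m A js) M"
    and "is": "is \<in> idx_lists k"
  shows "vec.cdiff (\<lambda>m. potential_coeff (T m) A A' is) M"
  unfolding potential_coeff_def symmetrise_def lower_all_def divide_inverse
  by (intro vec.cdiff_mult vec.cdiff_sum vec.cdiff_const T) (use "is" in \<open>auto simp: idx_lists_def\<close>)

section \<open>The heavenly coframe\<close>

lemma all_22: "(\<forall>a :: 2 \<times> 2. P a) \<longleftrightarrow> P (0, 0) \<and> P (0, 1) \<and> P (1, 0) \<and> P (1, 1)"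
proof safe
  fix i j :: 2
  assume "P (0, 0)" "P (0, 1)" "P (1, 0)" "P (1, 1)"
  then show "P (i, j)" using exhaust_2_01[of i] exhaust_2_01[of j] by auto
qed auto

text \<open>With y = x^00, x = - x^10, w = x^01, z = x^11 the last assumption is the second heavenly
  equation \<Theta>_xw + \<Theta>_yz + \<Theta>_xx \<Theta>_yy - \<Theta>_xy^2 = 0.\<close>

locale heavenly =
  fixes M :: "pt4 set" and \<Theta> :: "pt4 \<Rightarrow> complex"
  assumes open_M: "open M" and cdiff_\<Theta>: "vec.cdiff \<Theta> M"
    and heavenly_equation: "\<And>m. m \<in> M \<Longrightarrow>
      D (\<lambda>m. D \<Theta> m (axis (1, 0) 1)) m (axis (0, 1) 1) - D (\<lambda>m. D \<Theta> m (axis (0, 0) 1)) m (axis (1, 1) 1)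
      = theta_yy \<Theta> m * theta_xx \<Theta> m - (theta_xy \<Theta> m)\<^sup>2"
begin

abbreviation "e00 \<equiv> axis (0, 0) 1 :: pt4"
abbreviation "e01 \<equiv> axis (0, 1) 1 :: pt4"
abbreviation "e10 \<equiv> axis (1, 0) 1 :: pt4"
abbreviation "e11 \<equiv> axis (1, 1) 1 :: pt4"

text \<open>Together p, q, s form the Hessian of \<Theta> in x^00 and x^10; the sign in q undoes
  that of x = - x^10.\<close>

abbreviation "p \<equiv> theta_yy \<Theta>"
abbreviation "q \<equiv> \<lambda>m. - theta_xy \<Theta> m"
abbreviation "s \<equiv> theta_xx \<Theta>"

lemma pqs_eq:
  "p = (\<lambda>m. D (\<lambda>m. D \<Theta> m e00) m e00)"
  "q = (\<lambda>m. D (\<lambda>m. D \<Theta> m e00) m e10)"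
  "s = (\<lambda>m. D (\<lambda>m. D \<Theta> m e10) m e10)"
  by (auto simp: theta_yy_def theta_xx_def theta_xy_def pd_def[abs_def])

lemma cdiff_pqs: "vec.cdiff p M" "vec.cdiff q M" "vec.cdiff s M"
  unfolding pqs_eq
  by (intro vec.cdiff_directional_derivative open_M cdiff_\<Theta>)+

lemma D_third_derivative_commute:
  assumes "m \<in> M"
  shows "D (\<lambda>m. D (\<lambda>m. D \<Theta> m u) m v) m w = D (\<lambda>m. D (\<lambda>m. D \<Theta> m v) m u) m w"
    and "D (\<lambda>m. D (\<lambda>m. D \<Theta> m u) m v) m w = D (\<lambda>m. D (\<lambda>m. D \<Theta> m u) m w) m v"
proof -
  show "D (\<lambda>m. D (\<lambda>m. D \<Theta> m u) m v) m w = D (\<lambda>m. D (\<lambda>m. D \<Theta> m v) m u) m w"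
    by (rule fun_cong[OF vec.D_cong_open[OF open_M assms]])
       (rule vec.directional_derivatives_commute[OF open_M cdiff_\<Theta>])
  show "D (\<lambda>m. D (\<lambda>m. D \<Theta> m u) m v) m w = D (\<lambda>m. D (\<lambda>m. D \<Theta> m u) m w) m v"
    by (intro vec.directional_derivatives_commute[OF open_M _ assms]
        vec.cdiff_directional_derivative open_M cdiff_\<Theta>)
qed

text \<open>Symmetry of third derivatives gives the first two relations; differentiating the
  heavenly equation along x^00 and x^10 gives the last two. These are the integrability relations
  behind the vanishing of the primed connection.\<close>

lemma D_pqs:
  assumes m: "m \<in> M"
  shows "D p m e10 = D q m e00" "D s m e00 = D q m e10"
    and "D q m e01 - D p m e11 = D p m e00 * s m + p m * D s m e00 - 2 * q m * D q m e00"
    and "D s m e01 - D q m e11 = D p m e10 * s m + p m * D s m e10 - 2 * q m * D q m e10"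
proof -
  note comm = D_third_derivative_commute[OF m]
  show "D p m e10 = D q m e00" unfolding pqs_eq by (rule comm)
  show "D s m e00 = D q m e10" unfolding pqs_eq
    by (metis comm)
  let ?f = "\<lambda>m. D (\<lambda>m. D \<Theta> m e10) m e01 - D (\<lambda>m. D \<Theta> m e00) m e11"
  have c: "vec.cdiff (\<lambda>m. D (\<lambda>m. D \<Theta> m u) m v) M" for u v
    by (intro vec.cdiff_directional_derivative open_M cdiff_\<Theta>)
  have *: "D (\<lambda>m. D (\<lambda>m. D \<Theta> m e10) m e01) m v - D (\<lambda>m. D (\<lambda>m. D \<Theta> m e00) m e11) m v
      = D p m v * s m + p m * D s m v - 2 * q m * D q m v" for v
  proof -
    have 1: "(?f has_derivative (\<lambda>v. D (\<lambda>m. D (\<lambda>m. D \<Theta> m e10) m e01) m v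
        - D (\<lambda>m. D (\<lambda>m. D \<Theta> m e00) m e11) m v)) (at m)"
      by (intro has_derivative_diff vec.cdiffD(1)[OF c m])
    have "((\<lambda>m. p m * s m - q m * q m) has_derivative
        (\<lambda>v. (p m * D s m v + D p m v * s m) - (q m * D q m v + D q m v * q m))) (at m)"
      by (intro has_derivative_diff has_derivative_mult vec.cdiffD(1)[OF _ m] cdiff_pqs)
    then have "(?f has_derivative
        (\<lambda>v. (p m * D s m v + D p m v * s m) - (q m * D q m v + D q m v * q m))) (at m)"
      by (rule has_derivative_transform_within_open[OF _ open_M m])
         (simp add: heavenly_equation power2_eq_square)
    from fun_cong[OF has_derivative_unique[OF 1 this], of v] show ?thesis
      by (simp add: algebra_simps)
  qed
  have "D (\<lambda>m. D (\<lambda>m. D \<Theta> m e10) m e01) m e00 = D q m e01"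
    "D (\<lambda>m. D (\<lambda>m. D \<Theta> m e00) m e11) m e00 = D p m e11"
    "D (\<lambda>m. D (\<lambda>m. D \<Theta> m e10) m e01) m e10 = D s m e01"
    "D (\<lambda>m. D (\<lambda>m. D \<Theta> m e00) m e11) m e10 = D q m e11"
    unfolding pqs_eq by (metis comm)+
  with *[of e00] *[of e10] show
    "D q m e01 - D p m e11 = D p m e00 * s m + p m * D s m e00 - 2 * q m * D q m e00"
    "D s m e01 - D q m e11 = D p m e10 * s m + p m * D s m e10 - 2 * q m * D q m e10"
    by simp_all
qed

section \<open>The dual frame and the Levi-Civita connection\<close>

abbreviation "\<theta> \<equiv> heavenly_coframe \<Theta>"

text \<open>The dual frame in closed form, identified with the description \<open>frame\<close> in
  \<open>frame_eq\<close>. The vectors with A' = 0 are constant coordinate vectors.\<close>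

definition E :: "2 \<Rightarrow> 2 \<Rightarrow> pt4 \<Rightarrow> pt4" where
  "E A A' m = (if A' = 0 then axis (A, 0) 1
     else if A = 0 then e01 + q m *s e00 - p m *s e10
     else e11 + s m *s e00 - q m *s e10)"

lemma coframe_eq:
  "\<theta> 0 0 m u = u $ (0, 0) - q m * u $ (0, 1) - s m * u $ (1, 1)"
  "\<theta> 0 1 m u = u $ (0, 1)"
  "\<theta> 1 0 m u = u $ (1, 0) + p m * u $ (0, 1) + q m * u $ (1, 1)"
  "\<theta> 1 1 m u = u $ (1, 1)"
  by (simp_all add: heavenly_coframe_def dx_def dy_def dw_def dz_def)

lemma coframe_linear:
  "\<theta> A A' m (u + v) = \<theta> A A' m u + \<theta> A A' m v"
  "\<theta> A A' m (u - v) = \<theta> A A' m u - \<theta> A A' m v"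
  "\<theta> A A' m (a *s u) = a * \<theta> A A' m u"
  using exhaust_2_01[of A] exhaust_2_01[of A'] by (auto simp: coframe_eq algebra_simps)

lemma coframe_E: "\<theta> A A' m (E B B' m) = (if A = B \<and> A' = B' then 1 else 0)"
  using exhaust_2_01[of A] exhaust_2_01[of A'] exhaust_2_01[of B] exhaust_2_01[of B']
  by (auto simp: coframe_eq E_def axis_def)

lemma coframe_inject:
  assumes "\<And>A A'. \<theta> A A' m u = \<theta> A A' m v"
  shows "u = v"
  using assms[of 0 0] assms[of 0 1] assms[of 1 0] assms[of 1 1]
  by (simp add: coframe_eq vec_eq_iff all_22 del: split_paired_All)

lemma E_expansion:
  "v = \<theta> 0 0 m v *s E 0 0 m + \<theta> 0 1 m v *s E 0 1 m + \<theta> 1 0 m v *s E 1 0 m + \<theta> 1 1 m v *s E 1 1 m"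
  by (rule coframe_inject[of m])
     (use exhaust_2_01 in \<open>auto simp: coframe_linear coframe_E\<close>)

lemma frame_eq: "frame \<theta> A A' m = E A A' m"
  unfolding frame_def
  by (rule the_equality) (auto simp: coframe_E intro!: coframe_inject[of m])

lemma metric_coframe: "heavenly_metric \<Theta> m u v =
    \<theta> 0 0 m u * \<theta> 1 1 m v - \<theta> 0 1 m u * \<theta> 1 0 m v - \<theta> 1 0 m u * \<theta> 0 1 m v + \<theta> 1 1 m u * \<theta> 0 0 m v"
  using heavenly_coframe_is_spin_coframe[of UNIV \<Theta>]
  by (simp add: spin_coframe_def UNIV_2_01 eps_def algebra_simps)

text \<open>This is the derivative of g(v, w) along u: only the metric coefficients that involve
  \<Theta> vary from point to point.\<close>

definition dg :: "pt4 \<Rightarrow> pt4 \<Rightarrow> pt4 \<Rightarrow> pt4 \<Rightarrow> complex" where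
  "dg m u v w = - 2 * (D s m u * v $ (1, 1) * w $ (1, 1) + D p m u * v $ (0, 1) * w $ (0, 1)
     + D q m u * (v $ (0, 1) * w $ (1, 1) + w $ (0, 1) * v $ (1, 1)))"

lemma D_metric:
  assumes "m \<in> M" and g: "\<forall>m\<in>M. g m = heavenly_metric \<Theta> m"
  shows "D (\<lambda>m. g m v w) m u = dg m u v w"
proof -
  have "D (\<lambda>m. g m v w) m = D (\<lambda>m. heavenly_metric \<Theta> m v w) m"
    by (rule vec.D_cong_open[OF open_M \<open>m \<in> M\<close>]) (simp add: g)
  also have "\<dots> = (\<lambda>u. dg m u v w)"
  proof -
    have "((\<lambda>m. dw v * dx w + dw w * dx v + (dz v * dy w + dz w * dy v)
        - 2 * s m * (dz v * dz w) - 2 * p m * (dw v * dw w)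
        - 2 * q m * (dw v * dz w + dw w * dz v)) has_derivative
        (\<lambda>u. 0 - 2 * D s m u * (dz v * dz w) - 2 * D p m u * (dw v * dw w)
        - 2 * D q m u * (dw v * dz w + dw w * dz v))) (at m)"
      by (intro has_derivative_diff has_derivative_const has_derivative_mult_left
          has_derivative_mult_right vec.cdiffD(1)[OF _ \<open>m \<in> M\<close>] cdiff_pqs)
    moreover have "(\<lambda>m. dw v * dx w + dw w * dx v + (dz v * dy w + dz w * dy v)
        - 2 * s m * (dz v * dz w) - 2 * p m * (dw v * dw w)
        - 2 * q m * (dw v * dz w + dw w * dz v)) = (\<lambda>m. heavenly_metric \<Theta> m v w)"
      by (simp add: heavenly_metric_def fun_eq_iff algebra_simps)
    ultimately have "((\<lambda>m. heavenly_metric \<Theta> m v w) has_derivative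
        (\<lambda>u. 0 - 2 * D s m u * (dz v * dz w) - 2 * D p m u * (dw v * dw w)
        - 2 * D q m u * (dw v * dz w + dw w * dz v))) (at m)" by simp
    from frechet_derivative_at[OF this] show ?thesis
      by (auto simp: fun_eq_iff dg_def dw_def dz_def algebra_simps)
  qed
  finally show ?thesis by simp
qed

text \<open>This is g(\<nabla>_u v, w) for coordinate-constant u and v.\<close>

definition koszul :: "pt4 \<Rightarrow> pt4 \<Rightarrow> pt4 \<Rightarrow> pt4 \<Rightarrow> complex" where
  "koszul m u v w = (dg m u v w + dg m v u w - dg m w u v) / 2"

lemma koszul_linear:
  assumes "m \<in> M"
  shows "koszul m u v (w + w') = koszul m u v w + koszul m u v w'"
    "koszul m u v (a *s w) = a * koszul m u v w"
  using assms
  by (auto simp: koszul_def dg_def vec.linear_D[OF cdiff_pqs(1)] vec.linear_D[OF cdiff_pqs(2)]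
      vec.linear_D[OF cdiff_pqs(3)] vec.cdiffD(2)[OF cdiff_pqs(1)] vec.cdiffD(2)[OF cdiff_pqs(2)]
      vec.cdiffD(2)[OF cdiff_pqs(3)] field_simps)

text \<open>In the type \<open>2\<close>, \<open>1 - A\<close> is the index other than A. The metric
  pairs a frame vector only with the one whose two indices are both flipped, up to the sign given by
  \<open>eps\<close>, so pairing with that vector reads off a component.\<close>

lemma coframe_levi_civita:
  assumes m: "m \<in> M" and g: "\<forall>m\<in>M. g m = heavenly_metric \<Theta> m"
  shows "\<theta> A A' m (levi_civita g m u v) = eps A (1 - A) * eps A' (1 - A') * koszul m u v (E (1 - A) (1 - A') m)"
proof -
  let ?k = "\<lambda>A A'. koszul m u v (E A A' m)"
  define c where "c = ?k 1 1 *s E 0 0 m - ?k 1 0 *s E 0 1 m - ?k 0 1 *s E 1 0 m + ?k 0 0 *s E 1 1 m"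
  have c: "\<theta> A A' m c = eps A (1 - A) * eps A' (1 - A') * ?k (1 - A) (1 - A')" for A A'
    using exhaust_2_01[of A] exhaust_2_01[of A']
    by (auto simp: c_def coframe_linear coframe_E eps_def)
  have gc: "g m c w = koszul m u v w" for w
  proof -
    have "koszul m u v w = \<theta> 0 0 m w * ?k 0 0 + \<theta> 0 1 m w * ?k 0 1 + \<theta> 1 0 m w * ?k 1 0
        + \<theta> 1 1 m w * ?k 1 1"
      by (subst E_expansion[of w m]) (simp add: koszul_linear[OF m])
    then show ?thesis
      using m g by (simp add: metric_coframe c eps_def algebra_simps)
  qed
  have "levi_civita g m u v = c"
    unfolding levi_civita_def D_metric[OF m g]
  proof (rule the_equality)
    show "\<forall>w. 2 * g m c w = dg m u v w + dg m v u w - dg m w u v"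
      by (simp add: gc koszul_def)
  next
    fix c' assume "\<forall>w. 2 * g m c' w = dg m u v w + dg m v u w - dg m w u v"
    then have "g m c' w = g m c w" for w
      by (simp add: gc koszul_def field_simps)
    then have *: "heavenly_metric \<Theta> m c' (E A A' m) = heavenly_metric \<Theta> m c (E A A' m)" for A A'
      using m g by simp
    show "c' = c"
    proof (rule coframe_inject[of m])
      show "\<theta> A A' m c' = \<theta> A A' m c" for A A'
        using *[of 0 0] *[of 0 1] *[of 1 0] *[of 1 1] exhaust_2_01[of A] exhaust_2_01[of A']
        by (auto simp: metric_coframe coframe_E)
    qed
  qed
  with c show ?thesis by simp
qed

text \<open>The frame vectors with A' = 0 are constant, and the others vary only within their span.
  The surviving terms for A = 0 and A = 1 are opposite and cancel in the trace over A that defines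
  the primed connection.\<close>

lemma coframe_D_E:
  assumes m: "m \<in> M"
  shows "\<theta> A B' m (D (E A A') m u) =
    (if A' = 1 \<and> B' = 0 then (if A = 0 then D q m u else - D q m u) else 0)"
proof -
  have d: "((\<lambda>m. f m *s e) has_derivative (\<lambda>u. D f m u *s e)) (at m)"
    if "vec.cdiff f M" for f and e :: pt4
    by (rule bounded_linear.has_derivative[OF
          bounded_bilinear.bounded_linear_left[OF bounded_bilinear_vector_scalar]
          vec.cdiffD(1)[OF that m]])
  have "D (E A A') m = (\<lambda>u. if A' = 0 then 0 else if A = 0 then 0 + D q m u *s e00 - D p m u *s e10
      else 0 + D s m u *s e00 - D q m u *s e10)"
  proof (rule frechet_derivative_at[symmetric])
    show "(E A A' has_derivative (\<lambda>u. if A' = 0 then 0 else if A = 0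
        then 0 + D q m u *s e00 - D p m u *s e10 else 0 + D s m u *s e00 - D q m u *s e10)) (at m)"
      using exhaust_2_01[of A] exhaust_2_01[of A']
      unfolding E_def[abs_def]
      by (elim disjE; simp only: if_True if_False zero_neq_one one_neq_zero refl;
          intro has_derivative_const has_derivative_add has_derivative_diff d cdiff_pqs)
  qed
  then show ?thesis
    using exhaust_2_01[of A] exhaust_2_01[of A'] exhaust_2_01[of B']
    by (auto simp: coframe_eq axis_def)
qed

lemma D_E:
  assumes "m \<in> M" "vec.cdiff f M"
  shows "D f m (E A A' m) = (if A' = 0 then D f m (axis (A, 0) 1)
     else if A = 0 then D f m e01 + q m * D f m e00 - p m * D f m e10
     else D f m e11 + s m * D f m e00 - q m * D f m e10)"
  using assms by (simp add: E_def vec.linear_D vec.cdiffD(2))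

text \<open>The frame derivatives cancel in the sum over A. The remaining Koszul terms are
  combinations of first derivatives of p, q, s that vanish identically or by
  \<open>D_pqs\<close>.\<close>

lemma primed_connection_eq_0:
  assumes m: "m \<in> M" and g: "\<forall>m\<in>M. g m = heavenly_metric \<Theta> m"
  shows "primed_connection g \<theta> m u A' B' = 0"
proof -
  have *: "primed_connection g \<theta> m u A' B' = 1 / 2 * (\<Sum>A\<in>UNIV.
      \<theta> A B' m (D (E A A') m u) + eps A (1 - A) * eps B' (1 - B') *
      koszul m u (E A A' m) (E (1 - A) (1 - B') m))"
    by (simp add: primed_connection_def frame_eq[abs_def] coframe_linear coframe_levi_civita[OF m g])
  have comp: "E 0 0 m $ (0, 0) = 1" "E 0 0 m $ (0, 1) = 0" "E 0 0 m $ (1, 0) = 0" "E 0 0 m $ (1, 1) = 0"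
    "E 1 0 m $ (0, 0) = 0" "E 1 0 m $ (0, 1) = 0" "E 1 0 m $ (1, 0) = 1" "E 1 0 m $ (1, 1) = 0"
    "E 0 1 m $ (0, 1) = 1" "E 0 1 m $ (1, 1) = 0" "E 1 1 m $ (0, 1) = 0" "E 1 1 m $ (1, 1) = 1"
    by (auto simp: E_def axis_def)
  note pqs = D_pqs[OF m]
  \<comment> \<open>Solved for the derivatives along x^01, the relations become rewrite rules that
    eliminate them in favour of derivatives along x^11.\<close>
  have q01: "D q m e01 = D p m e11 + (D p m e00 * s m + p m * D s m e00 - 2 * q m * D q m e00)"
    and s01: "D s m e01 = D q m e11 + (D p m e10 * s m + p m * D s m e10 - 2 * q m * D q m e10)"
    using pqs(3,4) by (simp_all add: algebra_simps)
  show ?thesis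
    using exhaust_2_01[of A'] exhaust_2_01[of B']
    by (auto simp: * UNIV_2_01 coframe_D_E[OF m] eps_def koszul_def dg_def comp
        D_E[OF m cdiff_pqs(1)] D_E[OF m cdiff_pqs(2)] D_E[OF m cdiff_pqs(3)] q01 s01 pqs(1,2)
        field_simps)
qed

lemma nabla_eq:
  assumes "m \<in> M" "\<forall>m\<in>M. g m = heavenly_metric \<Theta> m"
  shows "nabla g \<theta> \<phi> m A A' is = D (\<lambda>m. \<phi> m is) m (E A A' m)"
  by (simp add: nabla_def Let_def primed_connection_eq_0[OF assms] frame_eq)

lemma cdiff_coframe: "vec.cdiff (\<lambda>m. \<theta> A A' m u) M"
  using exhaust_2_01[of A] exhaust_2_01[of A']
  by (elim disjE; simp only: coframe_eq;
      intro vec.cdiff_add vec.cdiff_diff vec.cdiff_mult vec.cdiff_const cdiff_pqs)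

end

section \<open>Slices and twistor functions\<close>

definition dslice :: "(nat \<Rightarrow> 'i::finite) \<Rightarrow> pt4 \<Rightarrow> complex ^ (2 \<times> 'i)" where
  "dslice lab u = (\<chi> p. if snd p = lab 0 then u $ (fst p, 0)
     else if snd p = lab 1 then u $ (fst p, 1) else 0)"

lemma slice_has_derivative: "(slice lab c has_derivative dslice lab) (at m)"
proof -
  have "linear (dslice lab)"
    by (rule linearI) (auto simp: dslice_def vec_eq_iff)
  then have "(dslice lab has_derivative dslice lab) (at m)"
    by (simp add: linear_conv_bounded_linear bounded_linear_imp_has_derivative)
  then have "((\<lambda>m. dslice lab m + slice lab c 0) has_derivative (\<lambda>u. dslice lab u + 0)) (at m)"
    by (intro has_derivative_add has_derivative_const)
  moreover have "(\<lambda>m. dslice lab m + slice lab c 0) = slice lab c"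
    by (auto simp: dslice_def slice_def vec_eq_iff fun_eq_iff)
  ultimately show ?thesis by simp
qed

lemma dslice_scale: "dslice lab (a *s u) = a *s dslice lab u"
  by (auto simp: dslice_def vec_eq_iff)

lemma dslice_axis:
  assumes "lab 0 \<noteq> lab 1"
  shows "dslice lab (axis (A, 0) 1) = axis (A, lab 0) 1" "dslice lab (axis (A, 1) 1) = axis (A, lab 1) 1"
  using assms by (auto simp: dslice_def vec_eq_iff axis_def)

lemma slice_compose:
  assumes "vec.cdiff f N" "slice lab c ` M \<subseteq> N"
  shows "vec.cdiff (f \<circ> slice lab c) M"
    and "m \<in> M \<Longrightarrow> D (f \<circ> slice lab c) m u = D f (slice lab c m) (dslice lab u)"
proof -
  have *: "((f \<circ> slice lab c) has_derivative (\<lambda>u. D f (slice lab c m) (dslice lab u))) (at m)"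
    if "m \<in> M" for m
    unfolding comp_def using assms that
    by (intro has_derivative_compose[OF slice_has_derivative] vec.cdiffD(1)[where S = N]) auto
  then show "vec.cdiff (f \<circ> slice lab c) M"
    by (rule vec.cdiffI) (use assms in \<open>auto simp: dslice_scale vec.cdiffD(2)[where S = N]\<close>)
  show "D (f \<circ> slice lab c) m u = D f (slice lab c m) (dslice lab u)" if "m \<in> M"
    by (simp flip: frechet_derivative_at[OF *[OF that]])
qed

section \<open>Differentials of the twistor maps\<close>

lemma open_pi_cone: "open (pi_cone r)"
  unfolding pi_cone_def
  by (intro open_Collect_conj open_Collect_neq open_Collect_less continuous_intros)

lemma vector3_has_derivative:
  assumes "(f has_derivative f') F" "(g has_derivative g') F" "(h has_derivative h') F"
  shows "((\<lambda>z. vector [f z, g z, h z] :: complex ^ 3) has_derivative (\<lambda>v. vector [f' v, g' v, h' v])) F"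
proof -
  have v: "vector [a, b, c] = a *s axis 1 1 + b *s axis 2 1 + c *s (axis 3 1 :: complex ^ 3)" for a b c
    by (simp add: vec_eq_iff forall_3 axis_def)
  have *: "((\<lambda>z. f z *s e) has_derivative (\<lambda>v. f' v *s e)) F"
    if "(f has_derivative f') F" for f f' and e :: "complex ^ 3"
    by (rule bounded_linear.has_derivative[OF
          bounded_bilinear.bounded_linear_left[OF bounded_bilinear_vector_scalar] that])
  show ?thesis unfolding v by (intro has_derivative_add * assms)
qed

lemma vec_nth_differentiable: "(\<lambda>Z. Z $ k) differentiable (at (Z :: complex ^ 'k))"
  by (rule bounded_linear_imp_differentiable[OF bounded_linear_vec_nth])

lemma blow_down_differentiable: "blow_down n lab c differentiable (at Z)"
proof -
  have *: "(\<lambda>Z. Z $ 3 ^ (n - 1) * Z $ j + (\<Sum>i = 2..n. Z $ 3 ^ (n - i) * c $ (A, lab i)))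
      differentiable (at Z)" for j A
    by (intro differentiable_add differentiable_mult differentiable_power differentiable_sum ballI
        differentiable_const vec_nth_differentiable finite_atLeastAtMost)
  obtain f g h where "((\<lambda>Z. Z $ 3 ^ (n - 1) * Z $ 1 + (\<Sum>i = 2..n. Z $ 3 ^ (n - i) * c $ (0, lab i)))
      has_derivative f) (at Z)" "((\<lambda>Z. Z $ 3 ^ (n - 1) * Z $ 2 + (\<Sum>i = 2..n. Z $ 3 ^ (n - i) * c $ (1, lab i)))
      has_derivative g) (at Z)" "((\<lambda>Z. Z $ 3) has_derivative h) (at (Z :: complex ^ 3))"
    using *[of 1 0] *[of 2 1] vec_nth_differentiable[of 3 Z] unfolding differentiable_def by blast
  from vector3_has_derivative[OF this] show ?thesis
    unfolding blow_down_def[abs_def] differentiable_def by blast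
qed

text \<open>Only these values of T matter: \<open>nu_local\<close> will be evaluated with two
  vectors along which \<pi> is constant, and then the third vector enters the determinant through
  its \<lambda>-component alone.\<close>

lemma twistor_proj_has_derivative:
  assumes \<omega>: "\<And>A. pair.cdiff (\<omega> A) S" and z: "(x, \<pi>) \<in> S" and "\<pi> $ 1 \<noteq> 0"
  obtains T where "(twistor_proj n \<omega> has_derivative T) (at (x, \<pi>))"
    "\<And>u. T (u, 0) = vector [D (\<omega> 0) (x, \<pi>) (u, 0) / \<pi> $ 1 ^ n, D (\<omega> 1) (x, \<pi>) (u, 0) / \<pi> $ 1 ^ n, 0]"
    "\<And>v \<rho>. T (v, \<rho>) $ 3 = (\<rho> $ 0 * \<pi> $ 1 - \<pi> $ 0 * \<rho> $ 1) / (\<pi> $ 1)\<^sup>2"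
proof -
  have nth: "((\<lambda>z. snd z $ i) has_derivative (\<lambda>v. snd v $ i)) (at z)"
    for i and z :: "(complex ^ 'a) \<times> (complex ^ 2)"
    by (intro bounded_linear.has_derivative[OF bounded_linear_vec_nth] has_derivative_snd has_derivative_ident)
  define k' where "k' v = - (inverse (\<pi> $ 1 ^ n) * (of_nat n * v * \<pi> $ 1 ^ (n - 1)) * inverse (\<pi> $ 1 ^ n))" for v
  have inv: "((\<lambda>z. inverse (snd z $ 1 ^ n)) has_derivative (\<lambda>v. k' (snd v $ 1))) (at (x, \<pi>))"
    unfolding k'_def
    by (rule has_derivative_eq_rhs, rule Deriv.has_derivative_inverse[OF _ has_derivative_power[OF nth]])
       (use assms in \<open>auto simp: mult_ac\<close>)
  have comp: "((\<lambda>z. \<omega> A z * inverse (snd z $ 1 ^ n)) has_derivative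
      (\<lambda>v. \<omega> A (x, \<pi>) * k' (snd v $ 1) + D (\<omega> A) (x, \<pi>) v * inverse (\<pi> $ 1 ^ n))) (at (x, \<pi>))" for A
    using has_derivative_mult[OF pair.cdiffD(1)[OF \<omega> z] inv, of A] by simp
  have lam: "((\<lambda>z. snd z $ 0 / snd z $ 1) has_derivative
      (\<lambda>v. (snd v $ 0 * \<pi> $ 1 - \<pi> $ 0 * snd v $ 1) / (\<pi> $ 1 * \<pi> $ 1))) (at (x, \<pi>))"
    using has_derivative_divide'[OF nth[where i = 0 and z = "(x, \<pi>)"] nth[where i = 1 and z = "(x, \<pi>)"]] \<open>\<pi> $ 1 \<noteq> 0\<close> by simp
  have "twistor_proj n \<omega> = (\<lambda>z. vector [\<omega> 0 z * inverse (snd z $ 1 ^ n), \<omega> 1 z * inverse (snd z $ 1 ^ n),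
      snd z $ 0 / snd z $ 1])"
    by (simp add: twistor_proj_def[abs_def] Let_def divide_inverse)
  with vector3_has_derivative[OF comp[of 0] comp[of 1] lam]
  have T: "(twistor_proj n \<omega> has_derivative (\<lambda>v. vector
      [\<omega> 0 (x, \<pi>) * k' (snd v $ 1) + D (\<omega> 0) (x, \<pi>) v * inverse (\<pi> $ 1 ^ n),
       \<omega> 1 (x, \<pi>) * k' (snd v $ 1) + D (\<omega> 1) (x, \<pi>) v * inverse (\<pi> $ 1 ^ n),
       (snd v $ 0 * \<pi> $ 1 - \<pi> $ 0 * snd v $ 1) / (\<pi> $ 1 * \<pi> $ 1)])) (at (x, \<pi>))"
    by simp
  show thesis
    by (rule that[OF T]) (simp_all add: k'_def divide_inverse power2_eq_square)
qed

lemma vec_has_derivative: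
  fixes K :: "complex ^ 'k \<Rightarrow> complex ^ 'k"
  assumes "\<And>a. vec.cdiff (\<lambda>x. K x $ a) N" "x \<in> N"
  obtains K' where "(K has_derivative K') (at x)"
proof -
  have "((\<lambda>x. \<Sum>a\<in>UNIV. (K x $ a) *s axis a 1 :: complex ^ 'k) has_derivative
      (\<lambda>u. \<Sum>a\<in>UNIV. D (\<lambda>x. K x $ a) x u *s axis a 1)) (at x)"
    by (intro has_derivative_sum bounded_linear.has_derivative[OF
          bounded_bilinear.bounded_linear_left[OF bounded_bilinear_vector_scalar]]
        vec.cdiffD(1)[OF assms])
  then show thesis using that by (simp add: basis_expansion)
qed

lemma fibre_form_eq:
  "fibre_form \<omega> z (u, \<rho>) (v, \<sigma>) = wedge (D (\<omega> 0) z) (D (\<omega> 1) z) (u, 0) (v, 0)"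
  by (simp add: fibre_form_def wedge_def)

lemma lift_eq_of_tri_holomorphic_killing:
  assumes "tri_holomorphic N \<Phi>" "killing N \<Phi>" "fst z \<in> N"
  shows "lift K \<Phi> z = (K (fst z), 0)"
proof -
  obtain \<mu> where \<mu>: "\<Phi> (fst z) $ A' $ B' = (if A' = B' then \<mu> (fst z) else 0)" for A' B'
    using assms by (auto simp: tri_holomorphic_def)
  have "2 * \<mu> (fst z) = 0"
    using assms(2,3) by (auto simp: killing_def \<mu>)
  then have "\<Phi> (fst z) $ A' $ B' = 0" for A' B'
    using \<mu>[of A' B'] by simp
  then show ?thesis by (simp add: lift_def vec_eq_iff)
qed

text \<open>\<open>fibre_form\<close> agrees with the full 2-form built from the two differentials
  only on vectors that fix \<pi>. The lift and its derivative send such vectors to vectors of the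
  same kind, so the two Lie derivatives agree on them and \<open>contraction_closed\<close>
  applies.\<close>

lemma symmetry_contraction_closed:
  fixes K :: "complex ^ 'k \<Rightarrow> complex ^ 'k"
  assumes N: "open N" and \<omega>: "\<And>A. pair.cdiff (\<omega> A) (N \<times> pi_cone r)"
    and sym: "hierarchy_symmetry N r \<omega> K \<Phi>"
    and tri: "tri_holomorphic N \<Phi>" "killing N \<Phi>"
    and z: "z \<in> N \<times> pi_cone r"
  defines "\<alpha> \<equiv> \<lambda>z. wedge (D (\<omega> 0) z) (D (\<omega> 1) z) (K (fst z), 0)"
  shows "(\<lambda>z. \<alpha> z (v, 0)) differentiable (at z)"
    and "D (\<lambda>z. \<alpha> z (v, 0)) z (u, 0) = D (\<lambda>z. \<alpha> z (u, 0)) z (v, 0)"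
proof -
  let ?S = "N \<times> pi_cone r"
  let ?X = "\<lambda>z :: (complex ^ 'k) \<times> (complex ^ 2). (K (fst z), 0 :: complex ^ 2)"
  have S: "open ?S" by (intro open_Times N open_pi_cone)
  have "fst z \<in> N" using z by auto
  obtain K' where K': "(K has_derivative K') (at (fst z))"
    by (rule vec_has_derivative[OF _ \<open>fst z \<in> N\<close>, of K])
       (use sym in \<open>auto simp: hierarchy_symmetry_def holo_iff_cdiff\<close>)
  have X: "(?X has_derivative (\<lambda>u. (K' (fst u), 0))) (at z)"
    by (intro has_derivative_Pair has_derivative_const
        has_derivative_compose[OF has_derivative_fst[OF has_derivative_ident] K'])
  have "(lift K \<Phi> has_derivative (\<lambda>u. (K' (fst u), 0))) (at z)"
    by (rule has_derivative_transform_within_open[OF X S z])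
       (auto simp: lift_eq_of_tri_holomorphic_killing[OF tri])
  from frechet_derivative_at[OF this] frechet_derivative_at[OF X]
  have DX: "D (lift K \<Phi>) z = (\<lambda>u. (K' (fst u), 0))" "D ?X z = (\<lambda>u. (K' (fst u), 0))"
    by simp_all
  have Xz: "lift K \<Phi> z = ?X z"
    using lift_eq_of_tri_holomorphic_killing[OF tri \<open>fst z \<in> N\<close>] .
  have "lie_derivative2 (lift K \<Phi>) (fibre_form \<omega>) z (u, 0) (v, 0) = 0" for u v
    using sym z by (auto simp: hierarchy_symmetry_def)
  then have lie: "lie_derivative2 ?X (\<lambda>z. wedge (D (\<omega> 0) z) (D (\<omega> 1) z)) z (u, 0) (v, 0) = 0" for u v
    by (simp add: lie_derivative2_def DX Xz fibre_form_eq)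
  show "(\<lambda>z. \<alpha> z (v, 0)) differentiable (at z)"
    "D (\<lambda>z. \<alpha> z (v, 0)) z (u, 0) = D (\<lambda>z. \<alpha> z (u, 0)) z (v, 0)"
    unfolding \<alpha>_def
    by (rule pair.contraction_closed[OF S \<omega> \<omega> z X lie])+
qed

text \<open>Differentiating \<open>blow_up\<close> replaces the composite differential of p and the
  projection to \<open>\<P>\<T>\<^sub>1\<close> by that of the projection to
  \<open>\<P>\<T>\<^sub>n\<close> along the slice, so neither factor has to be computed. The
  determinant then factors, because its first two arguments have no \<lambda>-component.\<close>

lemma symmetry_form_eq:
  assumes slice: "slice lab c ` M \<subseteq> N" and M: "open M"
    and \<omega>: "\<And>A. pair.cdiff (\<omega> A) (N \<times> pi_cone r)"
    and \<omega>1: "\<And>A. pair.cdiff (\<omega>1 A) (M \<times> pi_cone r)"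
    and tri: "tri_holomorphic N \<Phi>" "killing N \<Phi>"
    and proj: "projects_to n N r \<omega> (lift K \<Phi>) \<K>"
    and blow_up: "\<forall>m\<in>M. \<forall>\<pi>\<in>pi_cone r.
      blow_down n lab c (twistor_proj 1 \<omega>1 (m, \<pi>)) = twistor_proj n \<omega> (slice lab c m, \<pi>)"
    and m: "m \<in> M" and \<pi>: "\<pi> \<in> pi_cone r"
  defines "x \<equiv> slice lab c m"
  shows "symmetry_form n lab c \<omega>1 \<K> (m, \<pi>) (u, 0) (v, \<rho>) =
      wedge (D (\<omega> 0) (x, \<pi>)) (D (\<omega> 1) (x, \<pi>)) (K x, 0) (dslice lab u, 0) * pi_dpi (m, \<pi>) (v, \<rho>)"
proof -
  have \<pi>1: "\<pi> $ 1 \<noteq> 0" using \<pi> by (simp add: pi_cone_def)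
  have xN: "(x, \<pi>) \<in> N \<times> pi_cone r" using slice m \<pi> by (auto simp: x_def)
  have mM: "(m, \<pi>) \<in> M \<times> pi_cone r" using m \<pi> by auto
  let ?P1 = "twistor_proj 1 \<omega>1" and ?B = "blow_down n lab c" and ?P = "twistor_proj n \<omega>"
  obtain T where T: "(?P has_derivative T) (at (x, \<pi>))"
    "\<And>u. T (u, 0) = vector [D (\<omega> 0) (x, \<pi>) (u, 0) / \<pi> $ 1 ^ n, D (\<omega> 1) (x, \<pi>) (u, 0) / \<pi> $ 1 ^ n, 0]"
    "\<And>v \<rho>. T (v, \<rho>) $ 3 = (\<rho> $ 0 * \<pi> $ 1 - \<pi> $ 0 * \<rho> $ 1) / (\<pi> $ 1)\<^sup>2"
    by (rule twistor_proj_has_derivative[where \<omega> = \<omega> and n = n, OF \<omega> xN \<pi>1]) blast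
  obtain T1 where T1: "(?P1 has_derivative T1) (at (m, \<pi>))"
    by (rule twistor_proj_has_derivative[where \<omega> = \<omega>1 and n = 1, OF \<omega>1 mM \<pi>1]) blast
  have B: "(?B has_derivative D ?B Z) (at Z)" for Z
    using blow_down_differentiable frechet_derivative_works by blast
  have "((\<lambda>z. ?B (?P1 z)) has_derivative (\<lambda>U. D ?B (?P1 (m, \<pi>)) (T1 U))) (at (m, \<pi>))"
    by (rule has_derivative_compose[OF T1 B])
  then have 1: "((\<lambda>z. ?P (slice lab c (fst z), snd z)) has_derivative
      (\<lambda>U. D ?B (?P1 (m, \<pi>)) (T1 U))) (at (m, \<pi>))"
    by (rule has_derivative_transform_within_open[OF _ open_Times[OF M open_pi_cone] mM])
       (use blow_up in auto)
  have "((\<lambda>z. (slice lab c (fst z), snd z)) has_derivative (\<lambda>U. (dslice lab (fst U), snd U))) (at (m, \<pi>))"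
    by (intro has_derivative_Pair has_derivative_snd has_derivative_ident
        has_derivative_compose[OF has_derivative_fst[OF has_derivative_ident] slice_has_derivative])
  from has_derivative_compose[OF this, of ?P T] T(1)
  have "((\<lambda>z. ?P (slice lab c (fst z), snd z)) has_derivative
      (\<lambda>U. T (dslice lab (fst U), snd U))) (at (m, \<pi>))"
    by (simp add: x_def)
  from has_derivative_unique[OF 1 this]
  have DB: "D ?B (?P1 (m, \<pi>)) (T1 U) = T (dslice lab (fst U), snd U)" for U
    by (rule fun_cong)
  have DP1: "D ?P1 (m, \<pi>) = T1" and DP: "D ?P (x, \<pi>) = T"
    using frechet_derivative_at[OF T1] frechet_derivative_at[OF T(1)] by simp_all
  have K: "\<K> (?P (x, \<pi>)) = T (K x, 0)"
  proof -
    have "D ?P (x, \<pi>) (lift K \<Phi> (x, \<pi>)) = \<K> (?P (x, \<pi>))"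
      using proj xN unfolding projects_to_def by blast
    moreover have "lift K \<Phi> (x, \<pi>) = (K x, 0)"
      using lift_eq_of_tri_holomorphic_killing[OF tri, of "(x, \<pi>)" K] xN by simp
    ultimately show ?thesis by (simp add: DP)
  qed
  have "symmetry_form n lab c \<omega>1 \<K> (m, \<pi>) (u, 0) (v, \<rho>) =
      \<pi> $ 1 ^ (2 * n + 2) * nu_local (T (K x, 0)) (T (dslice lab u, 0)) (T (dslice lab v, \<rho>))"
  proof -
    have "?B (?P1 (m, \<pi>)) = ?P (x, \<pi>)" using blow_up m \<pi> by (simp add: x_def)
    then show ?thesis
      unfolding symmetry_form_def pullback2_def DP1 DB by (simp only: K fst_conv snd_conv)
  qed
  also have "\<dots> = wedge (D (\<omega> 0) (x, \<pi>)) (D (\<omega> 1) (x, \<pi>)) (K x, 0) (dslice lab u, 0) *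
      (\<pi> $ 0 * \<rho> $ 1 - \<pi> $ 1 * \<rho> $ 0)"
  proof -
    define P where "P = \<pi> $ 1 ^ n"
    have "P \<noteq> 0" using \<pi>1 by (simp add: P_def)
    \<comment> \<open>The weight 2n + 2 is used up by the two factors \<pi>_1'^(-n) in the
      coordinates and the factor \<pi>_1'^(-2) in d\<lambda>.\<close>
    have "\<pi> $ 1 ^ (2 * n + 2) = P * P * (\<pi> $ 1)\<^sup>2"
      by (simp add: P_def power_add mult_2 power2_eq_square)
    moreover have "nu_local (T (K x, 0)) (T (dslice lab u, 0)) (T (dslice lab v, \<rho>)) =
        - (wedge (D (\<omega> 0) (x, \<pi>)) (D (\<omega> 1) (x, \<pi>)) (K x, 0) (dslice lab u, 0) / (P * P) *
          ((\<rho> $ 0 * \<pi> $ 1 - \<pi> $ 0 * \<rho> $ 1) / (\<pi> $ 1)\<^sup>2))"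
      by (simp add: nu_local_def det_3 T(2,3) wedge_def P_def[symmetric] diff_divide_distrib algebra_simps)
    ultimately show ?thesis
      using \<open>P \<noteq> 0\<close> \<pi>1 by (simp add: field_simps)
  qed
  also have "\<pi> $ 0 * \<rho> $ 1 - \<pi> $ 1 * \<rho> $ 0 = pi_dpi (m, \<pi>) (v, \<rho>)"
    by (simp add: pi_dpi_def raise_def eps_def UNIV_2_01)
  finally show ?thesis .
qed

text \<open>At \<lambda> = 0 the form \<open>\<Sigma>\<^sub>1\<close> is dw \<and> dz, which equals
  1 on the two coordinate vectors chosen. As a polynomial in \<lambda> on \<pi>_1' = 1 it stays
  nonzero nearby; this is what allows \<open>\<Sigma>\<^sub>1\<close> to be divided out when \<chi>
  is shown to vanish.\<close>

lemma fibre_form_nonzero: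
  fixes \<Theta> :: "pt4 \<Rightarrow> complex"
  assumes tw: "twistor_functions 1 of_nat M \<Theta> r \<omega>" and M: "open M" and m: "m \<in> M"
  obtains u v \<delta> where "0 < \<delta>" "\<delta> \<le> r"
    "\<And>\<pi>. \<pi> $ 1 = 1 \<Longrightarrow> norm (\<pi> $ 0) < \<delta> \<Longrightarrow> fibre_form \<omega> (m, \<pi>) (u, 0) (v, 0) \<noteq> 0"
proof -
  have r: "r > 0" and \<omega>: "\<And>A. pair.cdiff (\<omega> A) (M \<times> pi_cone r)"
    using tw by (auto simp: twistor_functions_def holo_pair_iff_cdiff)
  define \<pi>0 :: "complex ^ 2" where "\<pi>0 = axis 1 1"
  have \<pi>0: "\<pi>0 \<in> pi_cone r" "\<pi>0 $ 0 = 0" "\<pi>0 $ 1 = 1"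
    using r by (auto simp: \<pi>0_def pi_cone_def axis_def)
  have val: "\<omega> A (y, \<pi>0) = y $ (A, 1)" if y: "y \<in> M" for A y
  proof -
    \<comment> \<open>At \<lambda> = 0 the expansion reduces to its constant term, and for level 1
      this is x^A1.\<close>
    obtain a :: "2 \<Rightarrow> nat \<Rightarrow> complex" where a: "\<forall>i\<le>1. \<forall>A. a A (1 - i) = y $ (A, of_nat i)"
      "\<forall>A. \<forall>\<pi>\<in>pi_cone r. (\<lambda>k. (\<pi> $ 1) ^ 1 * (a A k * (\<pi> $ 0 / \<pi> $ 1) ^ k)) sums \<omega> A (y, \<pi>)"
      using tw y unfolding twistor_functions_def by blast
    have "(\<lambda>k. a A k * 0 ^ k) sums \<omega> A (y, \<pi>0)"
      using a(2)[rule_format, OF \<pi>0(1), of A] \<pi>0 by simp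
    then have "\<omega> A (y, \<pi>0) = a A 0"
      by (simp add: powser_sums_zero_iff)
    with a(1)[rule_format, of 1 A] show ?thesis by simp
  qed
  have D\<omega>: "D (\<omega> A) (m, \<pi>0) (u, 0) = u $ (A, 1)" for A u
  proof -
    have "((\<lambda>y. \<omega> A (y, \<pi>0)) has_derivative (\<lambda>u. D (\<omega> A) (m, \<pi>0) (u, 0))) (at m)"
      by (rule has_derivative_compose[OF has_derivative_Pair[OF has_derivative_ident has_derivative_const]])
         (rule pair.cdiffD(1)[OF \<omega>], use m \<pi>0 in auto)
    then have "((\<lambda>y. y $ (A, 1)) has_derivative (\<lambda>u. D (\<omega> A) (m, \<pi>0) (u, 0))) (at m)"
      by (rule has_derivative_transform_within_open[OF _ M m]) (simp add: val)
    from has_derivative_unique[OF this bounded_linear_imp_has_derivative[OF bounded_linear_vec_nth]]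
    show ?thesis by (rule fun_cong)
  qed
  define u v :: pt4 where "u = axis (0, 1) 1" and "v = axis (1, 1) 1"
  have one: "fibre_form \<omega> (m, \<pi>0) (u, 0) (v, 0) = 1"
    by (simp add: fibre_form_eq wedge_def D\<omega> u_def v_def axis_def)
  obtain s :: "nat \<Rightarrow> complex" where s: "\<forall>\<pi>\<in>pi_cone r. fibre_form \<omega> (m, \<pi>) (u, 0) (v, 0) =
      (\<Sum>k\<le>2 * 1. s k * (\<pi> $ 0) ^ k * (\<pi> $ 1) ^ (2 * 1 - k))"
    using tw m unfolding twistor_functions_def by blast
  define f where "f t = (\<Sum>k\<le>2. s k * t ^ k)" for t
  have fe: "fibre_form \<omega> (m, \<pi>) (u, 0) (v, 0) = f (\<pi> $ 0)"
    if "\<pi> $ 1 = 1" "norm (\<pi> $ 0) < r" for \<pi>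
    using s that by (simp add: pi_cone_def f_def)
  have "isCont f 0" unfolding f_def by (intro continuous_intros)
  moreover have "f 0 \<noteq> 0" using fe[of \<pi>0] one \<pi>0 r by simp
  ultimately obtain \<delta> where \<delta>: "\<delta> > 0" "\<And>t. dist 0 t < \<delta> \<Longrightarrow> f t \<noteq> 0"
    using continuous_at_avoid by blast
  show thesis
  proof
    show "0 < min \<delta> r" "min \<delta> r \<le> r" using \<delta> r by auto
    show "fibre_form \<omega> (m, \<pi>) (u, 0) (v, 0) \<noteq> 0" if "\<pi> $ 1 = 1" "norm (\<pi> $ 0) < min \<delta> r" for \<pi>
      using fe[of \<pi>] \<delta>(2)[of "\<pi> $ 0"] that by simp
  qed
qed

text \<open>The heavenly equation is the hierarchy equation for A = 0, B = 1, i = j = 1. It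
  differentiates only along x^A0 and x^A1, that is, along the slice, so it survives
  restriction.\<close>

lemma heavenly_slice:
  assumes "n \<ge> 1" and lab: "bij_betw lab {0..n} UNIV"
    and hierarchy: "hierarchy_solution n lab N \<Theta>"
    and M: "open M" and slice: "slice lab c ` M \<subseteq> N"
  shows "heavenly M (\<Theta> \<circ> slice lab c)"
proof
  have N: "open N" and \<Theta>: "vec.cdiff \<Theta> N"
    using hierarchy by (auto simp: hierarchy_solution_def holo_iff_cdiff)
  show "open M" by (rule M)
  show "vec.cdiff (\<Theta> \<circ> slice lab c) M" by (rule slice_compose[OF \<Theta> slice])
  fix m assume m: "m \<in> M"
  let ?x = "slice lab c m"
  have x: "?x \<in> N" using slice m by auto
  have "0 \<in> {0..n}" "1 \<in> {0..n}" using \<open>n \<ge> 1\<close> by auto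
  with bij_betw_imp_inj_on[OF lab] have lab01: "lab 0 \<noteq> lab 1"
    by (metis inj_onD zero_neq_one)
  have D2: "D (\<lambda>m. D (\<Theta> \<circ> slice lab c) m u) m v
      = D (\<lambda>x. D \<Theta> x (dslice lab u)) ?x (dslice lab v)" for u v
  proof -
    have "D (\<lambda>m. D (\<Theta> \<circ> slice lab c) m u) m = D ((\<lambda>x. D \<Theta> x (dslice lab u)) \<circ> slice lab c) m"
      by (rule vec.D_cong_open[OF M m]) (simp add: slice_compose(2)[OF \<Theta> slice])
    then show ?thesis
      using slice_compose(2)[OF vec.cdiff_directional_derivative[OF N \<Theta>] slice m] by simp
  qed
  have eq: "pd lab 0 1 (pd lab 1 0 \<Theta>) ?x - pd lab 1 1 (pd lab 0 0 \<Theta>) ?x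
      + poisson_yx lab (pd lab 0 0 \<Theta>) (pd lab 1 0 \<Theta>) ?x = 0"
  proof -
    have "\<forall>i\<in>{1..n}. \<forall>j\<in>{1..n}. pd lab 0 i (pd lab 1 (j - 1) \<Theta>) ?x - pd lab 1 j (pd lab 0 (i - 1) \<Theta>) ?x
        + poisson_yx lab (pd lab 0 (i - 1) \<Theta>) (pd lab 1 (j - 1) \<Theta>) ?x = 0"
      using hierarchy x unfolding hierarchy_solution_def by blast
    from this[rule_format, of 1 1] \<open>n \<ge> 1\<close> show ?thesis by simp
  qed
  have comm: "D (\<lambda>x. D \<Theta> x u) ?x v = D (\<lambda>x. D \<Theta> x v) ?x u" for u v
    by (rule vec.directional_derivatives_commute[OF N \<Theta> x])
  show "D (\<lambda>m. D (\<Theta> \<circ> slice lab c) m (axis (1, 0) 1)) m (axis (0, 1) 1)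
      - D (\<lambda>m. D (\<Theta> \<circ> slice lab c) m (axis (0, 0) 1)) m (axis (1, 1) 1)
      = theta_yy (\<Theta> \<circ> slice lab c) m * theta_xx (\<Theta> \<circ> slice lab c) m - (theta_xy (\<Theta> \<circ> slice lab c) m)\<^sup>2"
    using eq comm[of "axis (0, lab 0) 1" "axis (1, lab 0) 1"]
    by (simp add: theta_xx_def theta_yy_def theta_xy_def pd_def[abs_def] D2 dslice_axis[OF lab01]
        dslice_axis[OF lab01, simplified] poisson_yx_def power2_eq_square algebra_simps)
qed

section \<open>The potential\<close>

text \<open>Two evaluations separate the terms of the defining formula: with both arguments fixing
  \<pi> the factor \<pi>_B' d\<pi>^B' vanishes, and with one argument purely along \<pi> the form
  \<open>\<Sigma>\<^sub>1\<close> vanishes.\<close>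

lemma K_form_eq_contraction:
  assumes n: "n \<ge> 1" and slice: "slice lab c ` M \<subseteq> N" and M: "open M"
    and \<omega>: "\<And>A. pair.cdiff (\<omega> A) (N \<times> pi_cone r)"
    and \<omega>1: "\<And>A. pair.cdiff (\<omega>1 A) (M \<times> pi_cone r)"
    and tri: "tri_holomorphic N \<Phi>" "killing N \<Phi>"
    and proj: "projects_to n N r \<omega> (lift K \<Phi>) \<K>"
    and blow_up: "\<forall>m\<in>M. \<forall>\<pi>\<in>pi_cone r.
      blow_down n lab c (twistor_proj 1 \<omega>1 (m, \<pi>)) = twistor_proj n \<omega> (slice lab c m, \<pi>)"
    and spinors: "associated_spinors n lab c M \<theta> r \<omega>1 \<K> T X"
    and m: "m \<in> M" and \<pi>: "\<pi> \<in> pi_cone r" and \<theta>0: "\<And>A A'. \<theta> A A' m 0 = 0"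
  defines "x \<equiv> slice lab c m"
  shows "K_form n \<theta> T (m, \<pi>) (u, 0) =
      wedge (D (\<omega> 0) (x, \<pi>)) (D (\<omega> 1) (x, \<pi>)) (K x, 0) (dslice lab u, 0)"
    and "(\<Sum>is\<in>idx_lists (2 * n). X m is * spinor_power (raise \<pi>) is) *
      fibre_form \<omega>1 (m, \<pi>) (u, 0) (v, 0) = 0"
proof -
  have \<pi>1: "\<pi> $ 1 \<noteq> 0" using \<pi> by (simp add: pi_cone_def)
  have form: "wedge (K_form n \<theta> T (m, \<pi>)) (pi_dpi (m, \<pi>)) (u, 0) (v, \<rho>)
      + (\<Sum>is\<in>idx_lists (2 * n). X m is * spinor_power (raise \<pi>) is) * fibre_form \<omega>1 (m, \<pi>) (u, 0) (v, \<rho>)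
      = wedge (D (\<omega> 0) (x, \<pi>)) (D (\<omega> 1) (x, \<pi>)) (K x, 0) (dslice lab u, 0) * pi_dpi (m, \<pi>) (v, \<rho>)"
    for u v \<rho>
    using spinors m \<pi> symmetry_form_eq[OF slice M \<omega> \<omega>1 tri proj blow_up m \<pi>, of u v \<rho>]
    by (auto simp: associated_spinors_def x_def)
  have pi0: "pi_dpi (m, \<pi>) (u, 0) = 0" for u
    by (simp add: pi_dpi_def raise_def)
  show "(\<Sum>is\<in>idx_lists (2 * n). X m is * spinor_power (raise \<pi>) is) *
      fibre_form \<omega>1 (m, \<pi>) (u, 0) (v, 0) = 0"
    using form[of u v 0] by (simp add: wedge_def pi0)
  \<comment> \<open>A change of \<pi>_0' alone makes \<pi>_B' d\<pi>^B' equal to -\<pi>_1', which is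
    nonzero on the cone and can be cancelled.\<close>
  have "pi_dpi (m, \<pi>) (0, axis 0 1) = - \<pi> $ 1"
    by (simp add: pi_dpi_def raise_def eps_def UNIV_2_01 axis_def)
  moreover have "fibre_form \<omega>1 (m, \<pi>) (u, 0) (0, axis 0 1) = 0"
    using pair.linear_D(4)[OF \<omega>1, of "(m, \<pi>)"] m \<pi> by (simp add: fibre_form_eq wedge_def zero_prod_def)
  ultimately show "K_form n \<theta> T (m, \<pi>) (u, 0) =
      wedge (D (\<omega> 0) (x, \<pi>)) (D (\<omega> 1) (x, \<pi>)) (K x, 0) (dslice lab u, 0)"
    using form[of u 0 "axis 0 1"] \<pi>1 pi0[of u] by (simp add: wedge_def[of "K_form n \<theta> T (m, \<pi>)"])
qed

theorem lemma4p2: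
  fixes n :: nat
    and lab :: "nat \<Rightarrow> 'i::finite"
    and N :: "(complex ^ (2 \<times> 'i)) set"
    and \<Theta> :: "complex ^ (2 \<times> 'i) \<Rightarrow> complex"
    and r :: real
    and \<omega> :: "2 \<Rightarrow> (2 \<times> 'i) spin_pt \<Rightarrow> complex"
    and K :: "complex ^ (2 \<times> 'i) \<Rightarrow> complex ^ (2 \<times> 'i)"
    and \<Phi> :: "complex ^ (2 \<times> 'i) \<Rightarrow> complex ^ 2 ^ 2"
    and \<K> :: "complex ^ 3 \<Rightarrow> complex ^ 3"
    and c :: "complex ^ (2 \<times> 'i)"
    and M :: "pt4 set"
    and g :: metric4
    and \<theta> :: coframe4
    and \<omega>1 :: "2 \<Rightarrow> (2 \<times> 2) spin_pt \<Rightarrow> complex"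
    and K_spinor :: "pt4 \<Rightarrow> 2 \<Rightarrow> 2 list \<Rightarrow> complex"
    and chi_spinor :: "pt4 \<Rightarrow> 2 list \<Rightarrow> complex"
  assumes "n \<ge> 1" and "bij_betw lab {0..n} UNIV"
    and theta: "\<theta> = heavenly_coframe (\<Theta> \<circ> slice lab c)"
    and hyper_kaehler: "hyper_kaehler M g \<theta>"
    and hierarchy: "hierarchy_solution n lab N \<Theta>"
    and embedding: "hierarchy_slice lab N \<Theta> c M g"
    and twistor_n: "twistor_functions n lab N \<Theta> r \<omega>"
    and symmetry: "hierarchy_symmetry N r \<omega> K \<Phi>"
    and tri_holomorphic: "tri_holomorphic N \<Phi>"
    and killing: "killing N \<Phi>"
    and projection: "projects_to n N r \<omega> (lift K \<Phi>) \<K>"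
    and twistor_1: "twistor_functions 1 of_nat M (\<Theta> \<circ> slice lab c) r \<omega>1"
    and blow_up: "\<forall>m\<in>M. \<forall>\<pi>\<in>pi_cone r.
      blow_down n lab c (twistor_proj 1 \<omega>1 (m, \<pi>)) = twistor_proj n \<omega> (slice lab c m, \<pi>)"
    and spinors: "associated_spinors n lab c M \<theta> r \<omega>1 \<K> K_spinor chi_spinor"
  shows "(\<forall>m\<in>M. \<forall>is\<in>idx_lists (2 * n). chi_spinor m is = 0) \<and>
    (\<forall>U. U \<subseteq> M \<and> open U \<and> starlike U \<longrightarrow>
       (\<exists>\<phi>. spinor_field (2 * n) U \<phi> \<and>
          (\<forall>m\<in>U. \<forall>A A'. \<forall>is\<in>idx_lists (2 * n).
             nabla g \<theta> \<phi> m A A' is =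
               symmetrise (\<lambda>js. lower_all (K_spinor m) A (butlast js) * eps (last js) A') is)))"
proof -
  have M: "open M" using hyper_kaehler by (simp add: hyper_kaehler_def)
  have N: "open N" using hierarchy by (simp add: hierarchy_solution_def)
  have slice: "slice lab c ` M \<subseteq> N" and g: "\<forall>m\<in>M. g m = heavenly_metric (\<Theta> \<circ> slice lab c) m"
    using embedding by (auto simp: hierarchy_slice_def)
  have r: "r > 0" and \<omega>: "\<And>A. pair.cdiff (\<omega> A) (N \<times> pi_cone r)"
    and \<omega>1: "\<And>A. pair.cdiff (\<omega>1 A) (M \<times> pi_cone r)"
    using twistor_n twistor_1 by (auto simp: twistor_functions_def holo_pair_iff_cdiff)
  interpret heavenly M "\<Theta> \<circ> slice lab c"
    by (rule heavenly_slice[OF assms(1,2) hierarchy M slice])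
  have \<theta>_linear: "\<theta> A A' m (u + v) = \<theta> A A' m u + \<theta> A A' m v"
    "\<theta> A A' m (a *s u) = a * \<theta> A A' m u" for A A' m u v a
    by (simp_all add: theta coframe_linear)
  have \<theta>0: "\<theta> A A' m 0 = 0" for A A' m
    using \<theta>_linear(2)[of A A' m 0 0] by simp
  have \<pi>_cone: "\<pi> \<in> pi_cone r" if "\<pi> $ 1 = 1" "norm (\<pi> $ 0) < r" for \<pi>
    using that by (simp add: pi_cone_def)
  note contraction = K_form_eq_contraction[OF assms(1) slice M \<omega> \<omega>1 tri_holomorphic killing
      projection blow_up spinors _ _ \<theta>0]
  have chi: "chi_spinor m is = 0" if m: "m \<in> M" and "is": "is \<in> idx_lists (2 * n)" for m "is"
  proof -
    obtain u v \<delta> where \<delta>: "0 < \<delta>" "\<delta> \<le> r"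
      and nz: "\<And>\<pi>. \<pi> $ 1 = 1 \<Longrightarrow> norm (\<pi> $ 0) < \<delta> \<Longrightarrow> fibre_form \<omega>1 (m, \<pi>) (u, 0) (v, 0) \<noteq> 0"
      by (rule fibre_form_nonzero[OF twistor_1 M m]) blast
    show ?thesis
    proof (rule symmetric_form_cone_eq_0[OF _ \<delta>(1) _ "is"])
      show "chi_spinor m ks = chi_spinor m js" if "js \<in> idx_lists (2 * n)" "mset ks = mset js" for js ks
        using spinors m that unfolding associated_spinors_def spinor_field_def by blast
      show "(\<Sum>is\<in>idx_lists (2 * n). chi_spinor m is * spinor_power (raise \<pi>) is) = 0"
        if "\<pi> $ 1 = 1" "norm (\<pi> $ 0) < \<delta>" for \<pi>
        using contraction(2)[OF m \<pi>_cone, of \<pi> u v] nz[OF that] that \<delta>(2) by simp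
    qed
  qed
  define \<beta> where "\<beta> is m u = potential_form (\<lambda>A A'. \<theta> A A' m u) (K_spinor m) is" for "is" m u
  have \<beta>_linear: "\<beta> is m (u + v) = \<beta> is m u + \<beta> is m v" "\<beta> is m (a *s u) = a * \<beta> is m u" for "is" m u v a
    by (simp_all add: \<beta>_def potential_form_eq \<theta>_linear UNIV_2_01 algebra_simps)
  have \<beta>_mset: "\<beta> js m u = \<beta> is m u" if "mset js = mset is" for js "is" m u
    unfolding \<beta>_def potential_form_def by (rule symmetrise_mset_cong[OF that])
  have \<beta>_cdiff: "vec.cdiff (\<lambda>m. \<beta> is m u) M" if "is \<in> idx_lists (2 * n)" for "is" u
    unfolding \<beta>_def potential_form_eq theta
    by (intro vec.cdiff_sum vec.cdiff_mult cdiff_coframe cdiff_potential_coeff[OF _ that])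
       (use spinors in \<open>auto simp: associated_spinors_def spinor_field_def holo_iff_cdiff\<close>)
  have \<beta>_closed: "D (\<lambda>m. \<beta> is m v) m u = D (\<lambda>m. \<beta> is m u) m v"
    if m: "m \<in> M" and "is": "is \<in> idx_lists (2 * n)" for m "is" u v
  proof -
    \<comment> \<open>The numbers \<open>d is\<close> are the coefficients of the exterior
      derivative of the contraction restricted to the slice, evaluated on u and v. As this
      derivative vanishes for each \<pi>, so do its coefficients.\<close>
    define d where "d is = D (\<lambda>m. \<beta> is m v) m u - D (\<lambda>m. \<beta> is m u) m v" for "is"
    have "d is = 0"
    proof (rule symmetric_form_cone_eq_0[OF _ r _ "is"])
      show "d ks = d js" if "mset ks = mset js" for js ks
        by (simp add: d_def \<beta>_mset[OF that])
    next
      fix \<pi> :: "complex ^ 2" assume "\<pi> $ 1 = 1" "norm (\<pi> $ 0) < r"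
      then have \<pi>: "\<pi> \<in> pi_cone r" by (rule \<pi>_cone)
      let ?x = "slice lab c m"
      let ?\<alpha> = "\<lambda>v z. wedge (D (\<omega> 0) z) (D (\<omega> 1) z) (K (fst z), 0) (dslice lab v, 0)"
      have z: "(?x, \<pi>) \<in> N \<times> pi_cone r" using slice m \<pi> by auto
      have sum_D: "(\<Sum>is\<in>idx_lists (2 * n). D (\<lambda>m. \<beta> is m v) m u * spinor_power (raise \<pi>) is)
          = D (?\<alpha> v) (?x, \<pi>) (dslice lab u, 0)" for u v
      proof -
        have 1: "((\<lambda>m. \<Sum>is\<in>idx_lists (2 * n). \<beta> is m v * spinor_power (raise \<pi>) is) has_derivative
            (\<lambda>u. \<Sum>is\<in>idx_lists (2 * n). D (\<lambda>m. \<beta> is m v) m u * spinor_power (raise \<pi>) is)) (at m)"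
          by (intro has_derivative_sum has_derivative_mult_left vec.cdiffD(1)[OF \<beta>_cdiff m])
        \<comment> \<open>The contraction is differentiated on N x cone and composed with the slice
          at fixed \<pi>; uniqueness of derivatives then equates the result with the termwise
          derivative.\<close>
        have "(?\<alpha> v has_derivative D (?\<alpha> v) (?x, \<pi>)) (at (?x, \<pi>))"
          using symmetry_contraction_closed(1)[OF N \<omega> symmetry tri_holomorphic killing z]
          by (simp flip: frechet_derivative_works)
        from has_derivative_compose[OF has_derivative_Pair[OF slice_has_derivative has_derivative_const] this]
        have "((\<lambda>m. ?\<alpha> v (slice lab c m, \<pi>)) has_derivative
            (\<lambda>u. D (?\<alpha> v) (?x, \<pi>) (dslice lab u, 0))) (at m)" .
        then have "((\<lambda>m. \<Sum>is\<in>idx_lists (2 * n). \<beta> is m v * spinor_power (raise \<pi>) is) has_derivative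
            (\<lambda>u. D (?\<alpha> v) (?x, \<pi>) (dslice lab u, 0))) (at m)"
        proof (rule has_derivative_transform_within_open[OF _ M m])
          fix y assume y: "y \<in> M"
          show "?\<alpha> v (slice lab c y, \<pi>) = (\<Sum>is\<in>idx_lists (2 * n). \<beta> is y v * spinor_power (raise \<pi>) is)"
            using contraction(1)[OF y \<pi>, of v] K_form_eq_potential_form[OF assms(1), of \<theta> K_spinor y \<pi> v 0]
            by (simp add: \<beta>_def)
        qed
        from fun_cong[OF has_derivative_unique[OF 1 this]] show ?thesis .
      qed
      have "(\<Sum>is\<in>idx_lists (2 * n). d is * spinor_power (raise \<pi>) is)
          = D (?\<alpha> v) (?x, \<pi>) (dslice lab u, 0) - D (?\<alpha> u) (?x, \<pi>) (dslice lab v, 0)"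
        unfolding sum_D[symmetric] by (simp add: d_def left_diff_distrib sum_subtractf)
      also have "\<dots> = 0"
        using symmetry_contraction_closed(2)[OF N \<omega> symmetry tri_holomorphic killing z] by simp
      finally show "(\<Sum>is\<in>idx_lists (2 * n). d is * spinor_power (raise \<pi>) is) = 0" .
    qed
    then show ?thesis by (simp add: d_def)
  qed
  have "\<exists>\<phi>. spinor_field (2 * n) U \<phi> \<and>
          (\<forall>m\<in>U. \<forall>A A'. \<forall>is\<in>idx_lists (2 * n).
             nabla g \<theta> \<phi> m A A' is =
               symmetrise (\<lambda>js. lower_all (K_spinor m) A (butlast js) * eps (last js) A') is)"
    if U: "U \<subseteq> M" "open U" "starlike U" for U
  proof -
    have "\<exists>F. \<forall>m\<in>U. (F has_derivative \<beta> is m) (at m)" if "is": "is \<in> idx_lists (2 * n)" for "is"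
    proof -
      have lin: "linear (\<beta> is m)" for m
        using \<beta>_linear(2)[of "is" m "of_real _"]
        by (intro linearI) (simp_all add: \<beta>_linear vec.sc_of_real scaleR_conv_of_real)
      have closed: "D (\<lambda>m. \<beta> is m v) m u = D (\<lambda>m. \<beta> is m u) m v" if "m \<in> U" for m u v
        using \<beta>_closed[OF _ "is"] U(1) that by blast
      show ?thesis
        by (rule vec.Poincare_starlike[OF U(2,3) vec.cdiff_subset[OF \<beta>_cdiff[OF "is"] U(1)] lin closed])
           blast+
    qed
    then obtain F where F: "\<And>is m. is \<in> idx_lists (2 * n) \<Longrightarrow> m \<in> U \<Longrightarrow> (F is has_derivative \<beta> is m) (at m)"
      by metis
    \<comment> \<open>The potentials are chosen independently for each list, so their integration
      constants need not be symmetric. Using one representative list per multiset makes \<phi>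
      symmetric; its differential is unaffected, since \<beta> depends only on the multiset.\<close>
    define rep :: "2 list \<Rightarrow> 2 list" where "rep is = (SOME js. mset js = mset is)" for "is"
    have rep: "mset (rep is) = mset is" for "is"
      unfolding rep_def by (rule someI[of _ "is"]) simp
    define \<phi> where "\<phi> m is = F (rep is) m" for m "is"
    have \<phi>: "((\<lambda>m. \<phi> m is) has_derivative \<beta> is m) (at m)" if "is \<in> idx_lists (2 * n)" "m \<in> U" for "is" m
    proof -
      have "rep is \<in> idx_lists (2 * n)"
        using that mset_eq_length[OF rep[of "is"]] by (simp add: idx_lists_def)
      moreover have "\<beta> (rep is) m = \<beta> is m"
        by (rule ext) (rule \<beta>_mset[OF rep])
      ultimately show ?thesis
        using F[of "rep is" m] \<open>m \<in> U\<close> by (simp add: \<phi>_def)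
    qed
    have "spinor_field (2 * n) U \<phi>"
      unfolding spinor_field_def
    proof (intro conjI ballI allI impI)
      fix "is" assume "is": "is \<in> idx_lists (2 * n)"
      show "holo (\<lambda>m. \<phi> m is) U"
        \<comment> \<open>The potentials were found by real calculus; they are holomorphic because
          their differential \<beta> is complex linear.\<close>
        unfolding holo_iff_cdiff by (rule vec.cdiffI[OF \<phi>[OF "is"] \<beta>_linear(2)])
    next
      fix m "is" js assume "mset js = mset (is :: 2 list)"
      then show "\<phi> m js = \<phi> m is" by (simp add: \<phi>_def rep_def)
    qed
    moreover have "nabla g \<theta> \<phi> m A A' is =
        symmetrise (\<lambda>js. lower_all (K_spinor m) A (butlast js) * eps (last js) A') is"
      if m: "m \<in> U" and "is": "is \<in> idx_lists (2 * n)" for m A A' "is"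
    proof -
      have "nabla g \<theta> \<phi> m A A' is = D (\<lambda>m. \<phi> m is) m (E A A' m)"
        unfolding theta using m U(1) by (intro nabla_eq g) auto
      also have "\<dots> = \<beta> is m (E A A' m)"
        by (simp flip: frechet_derivative_at[OF \<phi>[OF "is" m]])
      also have "\<dots> = (\<Sum>B\<in>UNIV. \<Sum>B'\<in>UNIV. (if B = A \<and> B' = A' then 1 else 0) *
          potential_coeff (K_spinor m) B B' is)"
        by (simp add: \<beta>_def potential_form_eq theta coframe_E)
      also have "\<dots> = potential_coeff (K_spinor m) A A' is"
        using exhaust_2_01[of A] exhaust_2_01[of A'] by (auto simp: UNIV_2_01)
      finally show ?thesis by (simp add: potential_coeff_def)
    qed
    ultimately show ?thesis by blast
  qed
  with chi show ?thesis by blast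
qed

end
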